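(* Suppose the following hypotheses on the coefficients $F_1,F,h:\mathbb{R}^d\to\mathbb{R}^d$ and $G_1,G:\mathbb{R}^d\to\mathbb{R}^{d\times m}$ hold. (i) There are $L_1>0$ and $\gamma\ge 0$ such that for all $x,y\in\mathbb{R}^d$: $|F_1(x)-F_1(y)|\vee|G_1(x)-G_1(y)|\vee|h(x)-h(y)|\le L_1|x-y|$ and $|F(x)-F(y)|\vee|G(x)-G(y)|\le L_1(1+|x|^{\gamma}+|y|^{\gamma})|x-y|$. (ii) There are $\bar r>2$ and $L_2>0$ such that $(x-y)^T(F(x)-F(y))+\frac{\bar r-1}{2}|G(x)-G(y)|^2\le L_2|x-y|^2$ for all $x,y\in\mathbb{R}^d$. (iii) There are $\bar p>\bar r$ and $K_2>0$ such that $x^TF(x)+\frac{\bar p-1}{2}|G(x)|^2\le K_2(1+|x|^2)$ for all $x\in\mathbb{R}^d$. (iv) With $f=F_1+F$ and $g=G_1+G$, $f(0)=g(0)=h(0)=0$, and $K_1>0$ is a constant with $|F_1(x)|\vee|G_1(x)|\vee|h(x)|\le K_1|x|$ for all $x\in\mathbb R^d$. (v) There are positive constants $\alpha_1,\alpha_2$ with $\alpha_1\ge\alpha_2+\lambda K_1(2+K_1)$ and $\theta\in(0,\infty)$ such that for all $x\in\mathbb R^d$ $$2x^TF_1(x)+(1+\theta)|G_1(x)|^2\le-\alpha_1|x|^2,\qquad 2x^TF(x)+(1+\theta^{-1})|G(x)|^2\le\alpha_2|x|^2.$$ Then for any $\epsilon\in(0,\alpha_1-\alpha_2-\lambda K_1(2+K_1))$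 there exists $\hat\Delta\in(0,1)$ such that for all $\Delta\in(0,\hat\Delta)$ and any initial value $x_0\in\mathbb R^d$, the solution of the partially truncated EM method satisfies $$\mathbb E|X_\Delta(t_k)|^2\le|x_0|^2e^{-(\alpha_1-\alpha_2-\lambda K_1(2+K_1)-\epsilon)t_k}\qquad\text{for all }k\ge0.$$
   Context: Notation: $a\vee b=\max(a,b)$, $a\wedge b=\min(a,b)$; $|\cdot|$ is the Euclidean norm of a vector and the trace norm $|A|=\sqrt{\mathrm{trace}(A^TA)}$ of a matrix. $(\Omega,\mathcal F,\mathbb P)$ is a complete probability space with a filtration $\{\mathcal F_t\}_{t\ge0}$ satisfying the usual conditions; $B$ is an $m$-dimensional Brownian motion and $N$ a scalar Poisson process with jump intensity $\lambda>0$, both with respect to this filtration. Convention in (v): if there is no super-linear term $G$, set $\theta=0$ and $\theta^{-1}|G(x)|^2=0$; if the linear term $G_1$ is absent, set $\theta=\infty$ and $\theta|G_1(x)|^2=0$. Underlying SDE: $dx(t)=f(x(t^-))\,dt+g(x(t^-))\,dB(t)+h(x(t^-))\,dN(t)$, $x(0)=x_0$, with $f=F_1+F$, $g=G_1+G$. Partially truncated Euler–Maruyama (EM) method: $\mu:\mathbb R^+\to\mathbb R^+$ is strictly increasing with $\mu(n)\to\infty$ as $n\to\infty$ and $\sup_{|x|\le n}(|F(x)|\vee|G(x)|)\le\mu(n)$ for all $n\ge1$; $\mu^{-1}$ is its inverse. $\varphi:(0,1]\to(0,\infty)$ is strictly decreasing with $\lim_{\Delta\to0}\varphi(\Delta)=\infty$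 and $(\varphi(\Delta))^{\bar p}\le\Delta^{-1}\wedge\Delta^{-\bar p/4}$ for $\Delta\in(0,1]$ (it is understood that $\mu^{-1}(\varphi(\Delta))$ is defined). For a step size $\Delta$, $\pi_\Delta(x)=(|x|\wedge\mu^{-1}(\varphi(\Delta)))\frac{x}{|x|}$ (with $x/|x|=0$ for $x=0$), $F_\Delta(x)=F(\pi_\Delta(x))$, $G_\Delta(x)=G(\pi_\Delta(x))$, $f_\Delta=F_1+F_\Delta$, $g_\Delta=G_1+G_\Delta$. With $t_k=k\Delta$, the scheme is $X_\Delta(0)=x_0$, $X_\Delta(t_{k+1})=X_\Delta(t_k)+f_\Delta(X_\Delta(t_k))\Delta+g_\Delta(X_\Delta(t_k))(B(t_{k+1})-B(t_k))+h(X_\Delta(t_k))(N(t_{k+1})-N(t_k))$, $k\ge0$. *)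

theory Defs
  imports "HOL-Probability.Probability"
begin

text \<open>Vectors are \<^typ>\<open>real ^ 'd\<close>, matrices with \<open>d\<close> rows and \<open>m\<close> columns are
  \<^typ>\<open>real ^ 'm ^ 'd\<close>. On the latter the library norm is the trace norm:\<close>

lemma norm_matrix_trace:
  fixes A :: "real ^ 'm ^ 'd"
  shows "norm A = sqrt (trace (transpose A ** A))"
proof -
  have "trace (transpose A ** A) = (\<Sum>j\<in>UNIV. \<Sum>i\<in>UNIV. (A $ i $ j)\<^sup>2)"
    by (simp add: trace_def matrix_matrix_mult_def transpose_def power2_eq_square)
  also have "\<dots> = (\<Sum>i\<in>UNIV. \<Sum>j\<in>UNIV. (A $ i $ j)\<^sup>2)"
    by (rule sum.swap)
  also have "\<dots> = (\<Sum>i\<in>UNIV. (norm (A $ i))\<^sup>2)"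
    by (simp add: norm_vec_def L2_set_def sum_nonneg)
  finally show ?thesis
    by (simp add: norm_vec_def L2_set_def)
qed

text \<open>Library \<open>powr\<close> has \<open>0 powr 0 = 0\<close>; in the polynomial growth condition \<open>|x|\<^sup>0 = 1\<close> for
  every \<open>x\<close>.\<close>

definition npow :: "real \<Rightarrow> real \<Rightarrow> real" where
  "npow r a = (if a = 0 then 1 else r powr a)"

text \<open>Only the members of \<open>\<F>\<close> with index \<open>t \<ge> 0\<close> are relevant.\<close>

definition usual_conditions :: "'a measure \<Rightarrow> (real \<Rightarrow> 'a measure) \<Rightarrow> bool" where
  "usual_conditions M \<F> \<longleftrightarrow>
     (\<forall>t\<ge>0. subalgebra M (\<F> t)) \<and>
     (\<forall>s t. 0 \<le> s \<longrightarrow> s \<le> t \<longrightarrow> sets (\<F> s) \<subseteq> sets (\<F> t)) \<and>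
     (\<forall>t\<ge>0. (\<Inter>s\<in>{t<..}. sets (\<F> s)) = sets (\<F> t)) \<and>
     null_sets M \<subseteq> sets (\<F> 0)"

definition indep_of :: "'a measure \<Rightarrow> 'a measure \<Rightarrow> ('a \<Rightarrow> 'b::topological_space) \<Rightarrow> bool" where
  "indep_of M \<G> X \<longleftrightarrow>
     prob_space.indep_set M (sets \<G>) (sets (vimage_algebra (space M) X borel))"

definition brownian_motion ::
  "'a measure \<Rightarrow> (real \<Rightarrow> 'a measure) \<Rightarrow> (real \<Rightarrow> 'a \<Rightarrow> real ^ 'm) \<Rightarrow> bool" where
  "brownian_motion M \<F> B \<longleftrightarrow>
     (\<forall>t\<ge>0. B t \<in> borel_measurable (\<F> t)) \<and>
     (AE \<omega> in M. B 0 \<omega> = 0) \<and>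
     (AE \<omega> in M. continuous_on {0..} (\<lambda>t. B t \<omega>)) \<and>
     (\<forall>s t. 0 \<le> s \<longrightarrow> s < t \<longrightarrow>
        indep_of M (\<F> s) (\<lambda>\<omega>. B t \<omega> - B s \<omega>) \<and>
        distributed M lborel (\<lambda>\<omega>. B t \<omega> - B s \<omega>)
          (\<lambda>z. ennreal (\<Prod>i\<in>UNIV. normal_density 0 (sqrt (t - s)) (z $ i))))"

text \<open>Since the paths are almost surely nondecreasing, the truncated subtraction on
  \<^typ>\<open>nat\<close> is almost surely the true increment.\<close>

definition poisson_process ::
  "'a measure \<Rightarrow> (real \<Rightarrow> 'a measure) \<Rightarrow> real \<Rightarrow> (real \<Rightarrow> 'a \<Rightarrow> nat) \<Rightarrow> bool" where
  "poisson_process M \<F> rate N \<longleftrightarrow>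
     (\<forall>t\<ge>0. N t \<in> measurable (\<F> t) (count_space UNIV)) \<and>
     (AE \<omega> in M. N 0 \<omega> = 0) \<and>
     (AE \<omega> in M. mono_on {0..} (\<lambda>t. N t \<omega>)) \<and>
     (AE \<omega> in M. \<forall>t\<ge>0. continuous (at_right t) (\<lambda>s. N s \<omega>)) \<and>
     (\<forall>s t. 0 \<le> s \<longrightarrow> s < t \<longrightarrow>
        indep_of M (\<F> s) (\<lambda>\<omega>. N t \<omega> - N s \<omega>) \<and>
        distr M (count_space UNIV) (\<lambda>\<omega>. N t \<omega> - N s \<omega>)
          = measure_pmf (poisson_pmf (rate * (t - s))))"

text \<open>The growth function \<open>\<mu>\<close> lives on the half line \<open>[0, \<infinity>)\<close>; \<open>\<mu>_inv\<close> is the inverse of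
  its restriction to it, meaningful only on the range of that restriction.\<close>

definition \<mu>_inv :: "(real \<Rightarrow> real) \<Rightarrow> real \<Rightarrow> real" where
  "\<mu>_inv \<mu> = inv_into {0..} \<mu>"

definition trunc_growth ::
  "(real ^ 'd \<Rightarrow> real ^ 'd) \<Rightarrow> (real ^ 'd \<Rightarrow> real ^ 'm ^ 'd) \<Rightarrow> (real \<Rightarrow> real) \<Rightarrow> bool" where
  "trunc_growth F G \<mu> \<longleftrightarrow>
     strict_mono_on {0..} \<mu> \<and> (\<forall>n\<ge>0. 0 \<le> \<mu> n) \<and> filterlim \<mu> at_top at_top \<and>
     (\<forall>n\<ge>1. \<forall>x. norm x \<le> n \<longrightarrow> max (norm (F x)) (norm (G x)) \<le> \<mu> n)"

definition trunc_step :: "real \<Rightarrow> (real \<Rightarrow> real) \<Rightarrow> (real \<Rightarrow> real) \<Rightarrow> bool" where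
  "trunc_step pbar \<mu> \<phi> \<longleftrightarrow>
     (\<forall>\<Delta>\<in>{0<..1}. 0 < \<phi> \<Delta>) \<and>
     (\<forall>\<Delta>\<^sub>1\<in>{0<..1}. \<forall>\<Delta>\<^sub>2\<in>{0<..1}. \<Delta>\<^sub>1 < \<Delta>\<^sub>2 \<longrightarrow> \<phi> \<Delta>\<^sub>2 < \<phi> \<Delta>\<^sub>1) \<and>
     filterlim \<phi> at_top (at_right 0) \<and>
     (\<forall>\<Delta>\<in>{0<..1}. \<phi> \<Delta> powr pbar \<le> min (\<Delta> powr (-1)) (\<Delta> powr (- pbar / 4))) \<and>
     (\<forall>\<Delta>\<in>{0<..1}. \<phi> \<Delta> \<in> \<mu> ` {0..})"

text \<open>\<^term>\<open>sgn x\<close> is \<open>x / |x|\<close>, with value \<open>0\<close> at \<open>x = 0\<close>.\<close>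

definition trunc_proj ::
  "(real \<Rightarrow> real) \<Rightarrow> (real \<Rightarrow> real) \<Rightarrow> real \<Rightarrow> real ^ 'd \<Rightarrow> real ^ 'd" where
  "trunc_proj \<mu> \<phi> \<Delta> x = min (norm x) (\<mu>_inv \<mu> (\<phi> \<Delta>)) *\<^sub>R sgn x"

primrec truncated_EM ::
  "(real ^ 'd \<Rightarrow> real ^ 'd) \<Rightarrow> (real ^ 'd \<Rightarrow> real ^ 'd) \<Rightarrow>
   (real ^ 'd \<Rightarrow> real ^ 'm ^ 'd) \<Rightarrow> (real ^ 'd \<Rightarrow> real ^ 'm ^ 'd) \<Rightarrow>
   (real ^ 'd \<Rightarrow> real ^ 'd) \<Rightarrow> (real \<Rightarrow> real) \<Rightarrow> (real \<Rightarrow> real) \<Rightarrow>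
   (real \<Rightarrow> 'a \<Rightarrow> real ^ 'm) \<Rightarrow> (real \<Rightarrow> 'a \<Rightarrow> nat) \<Rightarrow>
   real \<Rightarrow> real ^ 'd \<Rightarrow> nat \<Rightarrow> 'a \<Rightarrow> real ^ 'd" where
  "truncated_EM F1 F G1 G h \<mu> \<phi> B N \<Delta> x0 0 \<omega> = x0"
| "truncated_EM F1 F G1 G h \<mu> \<phi> B N \<Delta> x0 (Suc k) \<omega> =
     (let X = truncated_EM F1 F G1 G h \<mu> \<phi> B N \<Delta> x0 k \<omega>;
          t = real k * \<Delta>; t' = real (Suc k) * \<Delta>;
          f\<^sub>\<Delta> = F1 X + F (trunc_proj \<mu> \<phi> \<Delta> X);
          g\<^sub>\<Delta> = G1 X + G (trunc_proj \<mu> \<phi> \<Delta> X)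
      in X + \<Delta> *\<^sub>R f\<^sub>\<Delta> + g\<^sub>\<Delta> *v (B t' \<omega> - B t \<omega>)
           + (real (N t' \<omega>) - real (N t \<omega>)) *\<^sub>R h X)"

text \<open>Dissipativity of the linear part \<open>(F\<^sub>1, G\<^sub>1)\<close> and of the super-linear part \<open>(F, G)\<close> with
  splitting parameter \<open>\<theta>\<close>. Besides \<open>0 < \<theta> < \<infinity>\<close> this admits the conventional values
  \<open>\<theta> = 0\<close> when \<open>G\<close> is absent and \<open>\<theta> = \<infinity>\<close> when \<open>G\<^sub>1\<close> is absent. In \<^typ>\<open>ereal\<close>, \<open>0 * \<infinity> = 0\<close>
  and \<^term>\<open>inverse (0::ereal)\<close> is \<open>\<infinity>\<close>, so that \<open>\<theta>\<^sup>-\<^sup>1 |G x|\<^sup>2\<close> and \<open>\<theta> |G\<^sub>1 x|\<^sup>2\<close>, respectively, are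
  then read as \<open>0\<close>.\<close>

definition dissipative_split ::
  "(real ^ 'd \<Rightarrow> real ^ 'd) \<Rightarrow> (real ^ 'd \<Rightarrow> real ^ 'd) \<Rightarrow>
   (real ^ 'd \<Rightarrow> real ^ 'm ^ 'd) \<Rightarrow> (real ^ 'd \<Rightarrow> real ^ 'm ^ 'd) \<Rightarrow>
   real \<Rightarrow> real \<Rightarrow> ereal \<Rightarrow> bool" where
  "dissipative_split F1 F G1 G \<alpha>1 \<alpha>2 \<theta> \<longleftrightarrow>
     (0 < \<theta> \<and> \<theta> < \<infinity> \<or> \<theta> = 0 \<and> (\<forall>x. G x = 0) \<or> \<theta> = \<infinity> \<and> (\<forall>x. G1 x = 0)) \<and>
     (\<forall>x. ereal (2 * (x \<bullet> F1 x)) + (1 + \<theta>) * ereal ((norm (G1 x))\<^sup>2) \<le> ereal (- \<alpha>1 * (norm x)\<^sup>2)) \<and>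
     (\<forall>x. ereal (2 * (x \<bullet> F x)) + (1 + inverse \<theta>) * ereal ((norm (G x))\<^sup>2) \<le> ereal (\<alpha>2 * (norm x)\<^sup>2))"

end

theory Submission
  imports Defs
begin

text \<open>Given the past up to \<open>t\<^sub>k\<close>, the second moment of \<open>X + \<Delta> f + g \<Delta>B + h \<Delta>N\<close> is
  \<open>|X|\<^sup>2 + \<Delta> (2 X\<bullet>f + |g|\<^sup>2) + \<lambda>\<Delta> (2 X\<bullet>h + |h|\<^sup>2) + \<Delta>\<^sup>2 |f + \<lambda> h|\<^sup>2\<close>, where \<open>f\<close>, \<open>g\<close> are the truncated
  coefficients. Truncation preserves the dissipativity bounds, so the first bracket is at most
  \<open>-(\<alpha>\<^sub>1 - \<alpha>\<^sub>2) |X|\<^sup>2\<close>, and the second is at most \<open>K\<^sub>1 (2 + K\<^sub>1) |X|\<^sup>2\<close>. Since \<open>|f|\<close> is at most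
  \<open>(const + \<phi>(\<Delta>)) |X|\<close> with \<open>\<phi>(\<Delta>) \<le> \<Delta>\<^sup>-\<^sup>1\<^sup>/\<^sup>4\<close>, the last term is at most \<open>\<epsilon> \<Delta> |X|\<^sup>2\<close> for small \<open>\<Delta>\<close>, and
  \<open>1 + x \<le> exp x\<close> gives the geometric decay. The mixed term \<open>E[\<Delta>B \<Delta>N]\<close> vanishes although the
  joint independence of \<open>B\<close> and \<open>N\<close> is not assumed.\<close>

section \<open>Moments of Gaussian vectors and Poisson variables\<close>


text \<open>Fubini for a product of one-variable functions. \<open>lborel\<close> is the image of
  the product measure indexed by \<open>Basis\<close>, so each coordinate \<open>i\<close> is
  matched with the basis vector \<open>axis i 1\<close>, and the integral over the product measure
  factors.\<close>

lemma has_bochner_integral_lborel_prod: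
  fixes f :: "'i::finite \<Rightarrow> real \<Rightarrow> real"
  assumes f: "\<And>i. has_bochner_integral lborel (f i) (c i)"
  shows "has_bochner_integral lborel (\<lambda>x :: real ^ 'i. \<Prod>i\<in>UNIV. f i (x $ i)) (\<Prod>i\<in>UNIV. c i)"
proof -
  let ?B = "Basis :: (real ^ 'i) set" and ?P = "\<Pi>\<^sub>M b\<in>(Basis :: (real ^ 'i) set). (lborel :: real measure)"
  let ?T = "\<lambda>y :: real ^ 'i \<Rightarrow> real. \<Sum>b\<in>?B. y b *\<^sub>R b"
  let ?f = "\<lambda>b. f (axis_index b)"
  interpret product_sigma_finite "\<lambda>_ :: real ^ 'i. lborel :: real measure" ..
  have B: "?B = range (\<lambda>i. axis i 1)" and inj: "inj (\<lambda>i :: 'i. axis i (1 :: real))"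
    by (auto simp: Basis_vec_def inj_on_def axis_eq_axis)
  have ind: "axis_index (axis i (1 :: real)) = i" for i :: 'i
    by (simp add: axis_index_def axis_eq_axis)
  have reindex: "(\<Prod>i\<in>UNIV. F i) = (\<Prod>b\<in>?B. F (axis_index b))" for F :: "'i \<Rightarrow> real"
    unfolding B by (subst prod.reindex[OF inj]) (simp add: ind)
  have lb: "(lborel :: (real ^ 'i) measure) = distr ?P borel ?T"
    by (subst lborel_def) (simp add: lborel_eq_real)
  have f': "integrable lborel (f i)" "integral\<^sup>L lborel (f i) = c i" for i
    using f[of i] by (auto simp: has_bochner_integral_iff)
  have [measurable]: "f i \<in> borel_measurable borel" for i
    using f'(1)[of i] by simp
  have T: "?T y $ axis_index b = y b" if "b \<in> ?B" for y b
  proof -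
    from \<open>b \<in> ?B\<close>[unfolded B] obtain i where b: "b = axis i 1" by blast
    have "?T y $ i = ?T y \<bullet> axis i 1" by (simp add: inner_axis)
    also have "\<dots> = y b" using that b by (simp only: inner_sum_left_Basis b)
    finally show ?thesis by (simp add: b ind)
  qed
  have eq: "(\<Prod>i\<in>UNIV. f i (?T y $ i)) = (\<Prod>b\<in>?B. ?f b (y b))" for y
    by (subst reindex) (simp del: sum_component vector_scaleR_component add: T cong: prod.cong)
  have "integrable lborel (\<lambda>x :: real ^ 'i. \<Prod>i\<in>UNIV. f i (x $ i))"
    unfolding lb by (subst integrable_distr_eq)
      (auto simp del: sum_component vector_scaleR_component simp: eq intro!: product_integrable_prod f')
  moreover have "(\<integral>x. (\<Prod>i\<in>UNIV. f i (x $ i)) \<partial>(lborel :: (real ^ 'i) measure)) = (\<Prod>i\<in>UNIV. c i)"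
    unfolding lb
    by (subst integral_distr)
       (auto simp del: sum_component vector_scaleR_component
          simp: eq product_integral_prod[OF finite_Basis f'(1)] f'(2) reindex[of c])
  ultimately show ?thesis by (simp add: has_bochner_integral_iff)
qed

text \<open>Both moments come from the identity E[n f(n)] = r E[f(n+1)], which is
  \<open>shift\<close>: the factor n cancels against n!. Taking f = 1 gives the mean, and f(n) = n
  the second moment.\<close>

lemma poisson_moments:
  fixes r :: real
  assumes r: "r > 0"
  shows "has_bochner_integral (measure_pmf (poisson_pmf r)) real r"
    and "has_bochner_integral (measure_pmf (poisson_pmf r)) (\<lambda>n. (real n)\<^sup>2) (r + r\<^sup>2)"
proof -
  have integral: "has_bochner_integral (measure_pmf (poisson_pmf r)) f c"
    if sums: "(\<lambda>n. (r ^ n / fact n * exp (- r)) * f n) sums c" and nn: "\<And>n. 0 \<le> f n"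
    for f :: "nat \<Rightarrow> real" and c
  proof -
    let ?g = "\<lambda>n. (r ^ n / fact n * exp (- r)) * f n"
    have "integrable (count_space UNIV) ?g"
      using sums nn r by (simp add: integrable_count_space_nat_iff sums_iff abs_mult)
    moreover from this have "integral\<^sup>L (count_space UNIV) ?g = c"
      using sums by (simp add: integral_count_space_nat sums_iff)
    ultimately show ?thesis
      using r by (simp add: measure_pmf_eq_density has_bochner_integral_iff integrable_density
          integral_density)
  qed
  have exp: "(\<lambda>n. r ^ n / fact n * exp (- r)) sums 1"
    using sums_mult2[OF exp_converges[of r], of "exp (- r)"]
    by (simp add: divide_inverse mult_ac exp_minus_inverse)
  have shift: "(\<lambda>n. (r ^ n / fact n * exp (- r)) * (real n * f n)) sums (r * c)"
    if "(\<lambda>n. (r ^ n / fact n * exp (- r)) * f (Suc n)) sums c" for f :: "nat \<Rightarrow> real" and c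
  proof -
    have eq: "(r ^ Suc n / fact (Suc n) * exp (- r)) * (real (Suc n) * f (Suc n))
        = r * ((r ^ n / fact n * exp (- r)) * f (Suc n))" for n
      by (simp add: divide_simps del: of_nat_Suc)
    let ?g = "\<lambda>n. (r ^ n / fact n * exp (- r)) * (real n * f n)"
    have "(\<lambda>n. ?g (Suc n)) sums (r * c)"
      using sums_mult[OF that, of r] by (simp only: eq)
    \<comment> \<open>The term at \<open>n = 0\<close> vanishes because of the factor
      \<open>real n\<close>, so the shifted series has the same sum.\<close>
    then show ?thesis by (subst (asm) sums_Suc_iff) simp
  qed
  have 1: "(\<lambda>n. (r ^ n / fact n * exp (- r)) * real n) sums r"
    using shift[of "\<lambda>_. 1" 1] exp by simp
  have "(\<lambda>n. (r ^ n / fact n * exp (- r)) * real (Suc n)) sums (r + 1)"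
    using sums_add[OF 1 exp] by (simp add: algebra_simps add_divide_distrib)
  then have 2: "(\<lambda>n. (r ^ n / fact n * exp (- r)) * (real n)\<^sup>2) sums (r + r\<^sup>2)"
    using shift[of real "r + 1"] by (simp add: power2_eq_square algebra_simps)
  show "has_bochner_integral (measure_pmf (poisson_pmf r)) real r"
    by (rule integral[OF 1]) simp
  show "has_bochner_integral (measure_pmf (poisson_pmf r)) (\<lambda>n. (real n)\<^sup>2) (r + r\<^sup>2)"
    by (rule integral[OF 2]) simp
qed

section \<open>Factorisation of expectations under independence from the past\<close>

text \<open>Takes the place of conditioning on \<open>\<G>\<close>: the events of
  \<open>\<xi>\<close> lie in \<open>\<G>\<close> and those of \<open>f (Y \<omega>)\<close> in the
  sigma-algebra of \<open>Y\<close>, so the two are independent. The general type of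
  \<open>Y\<close> covers Brownian increments (vectors) and Poisson increments (naturals).\<close>

lemma (in prob_space) has_bochner_integral_indep_of:
  fixes \<xi> :: "'a \<Rightarrow> real" and Y :: "'a \<Rightarrow> 'b :: topological_space"
  assumes indep: "indep_of M \<G> Y" and sub: "subalgebra M \<G>"
    and \<xi>: "\<xi> \<in> borel_measurable \<G>" "integrable M \<xi>"
    and Y [measurable]: "Y \<in> borel_measurable M"
    and f [measurable]: "f \<in> borel_measurable borel"
    and fY: "has_bochner_integral M (\<lambda>\<omega>. f (Y \<omega>)) c"
  shows "has_bochner_integral M (\<lambda>\<omega>. \<xi> \<omega> * f (Y \<omega>)) (expectation \<xi> * c)"
proof -
  have [measurable]: "\<xi> \<in> borel_measurable M" using \<xi>(2) by simp
  have sp: "space \<G> = space M" using sub by (simp add: subalgebra_def)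
  have sets_Y: "sets (vimage_algebra (space M) Y borel) = {Y -` A \<inter> space M | A. A \<in> sets borel}"
    by (rule sets_vimage_algebra2) auto
  have "indep_var borel \<xi> borel (\<lambda>\<omega>. f (Y \<omega>))"
    unfolding indep_var_eq
  proof (intro conjI)
    show "indep_set (sigma_sets (space M) {\<xi> -` A \<inter> space M |A. A \<in> sets borel})
      (sigma_sets (space M) {(\<lambda>\<omega>. f (Y \<omega>)) -` A \<inter> space M |A. A \<in> sets borel})"
      unfolding indep_set_def
    proof (rule indep_sets_mono_sets[OF indep[unfolded indep_of_def indep_set_def]], goal_cases)
      case (1 i)
      have "sigma_sets (space M) {\<xi> -` A \<inter> space M |A. A \<in> sets borel} \<subseteq> sets \<G>"
        using measurable_sets[OF \<xi>(1)] unfolding sp[symmetric]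
        by (intro sets.sigma_sets_subset) auto
      moreover have "sigma_sets (space M) {(\<lambda>\<omega>. f (Y \<omega>)) -` A \<inter> space M |A. A \<in> sets borel}
          \<subseteq> sets (vimage_algebra (space M) Y borel)"
      proof -
        have "(\<lambda>\<omega>. f (Y \<omega>)) -` A \<inter> space M = Y -` (f -` A) \<inter> space M" for A by auto
        moreover have "f -` A \<in> sets borel" if "A \<in> sets borel" for A
          using measurable_sets[OF f that] by simp
        ultimately have "{(\<lambda>\<omega>. f (Y \<omega>)) -` A \<inter> space M |A. A \<in> sets borel}
          \<subseteq> sets (vimage_algebra (space M) Y borel)"
          unfolding sets_Y by blast
        from sets.sigma_sets_subset[OF this] show ?thesis by simp
      qed
      ultimately show ?case by (cases i) auto
    qed
  qed measurable
  moreover have "integrable M (\<lambda>\<omega>. f (Y \<omega>))" "expectation (\<lambda>\<omega>. f (Y \<omega>)) = c"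
    using fY by (auto simp: has_bochner_integral_iff)
  ultimately show ?thesis
    using \<xi>(2) by (simp add: has_bochner_integral_iff indep_var_lebesgue_integral indep_var_integrable)
qed

section \<open>Moments of the driving increments\<close>


locale jump_diffusion_noise = prob_space M for M :: "'a measure" +
  fixes \<F> :: "real \<Rightarrow> 'a measure" and B :: "real \<Rightarrow> 'a \<Rightarrow> real ^ 'm"
    and N :: "real \<Rightarrow> 'a \<Rightarrow> nat" and lam :: real
  assumes usual: "usual_conditions M \<F>" and brownian: "brownian_motion M \<F> B"
    and lam_pos: "lam > 0" and poisson: "poisson_process M \<F> lam N"
begin

lemma subalgebra_filtration: "0 \<le> t \<Longrightarrow> subalgebra M (\<F> t)"
  using usual by (simp add: usual_conditions_def)

lemma filtration_mono:
  assumes "0 \<le> s" "s \<le> t" "f \<in> measurable (\<F> s) K"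
  shows "f \<in> measurable (\<F> t) K"
proof -
  have "subalgebra (\<F> t) (\<F> s)"
    using usual subalgebra_filtration[of s] subalgebra_filtration[of t] assms(1,2)
    by (auto simp: usual_conditions_def subalgebra_def)
  from measurable_from_subalg[OF this assms(3)] show ?thesis .
qed

lemma filtration_measurable: "0 \<le> s \<Longrightarrow> f \<in> measurable (\<F> s) K \<Longrightarrow> f \<in> measurable M K"
  using subalgebra_filtration measurable_from_subalg by blast

lemma B_adapted: "0 \<le> s \<Longrightarrow> s \<le> t \<Longrightarrow> B s \<in> borel_measurable (\<F> t)"
  by (rule filtration_mono[of s]) (use brownian in \<open>auto simp: brownian_motion_def\<close>)

lemma N_adapted: "0 \<le> s \<Longrightarrow> s \<le> t \<Longrightarrow> N s \<in> measurable (\<F> t) (count_space UNIV)"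
  by (rule filtration_mono[of s]) (use poisson in \<open>auto simp: poisson_process_def\<close>)

lemma B_measurable [measurable]: "0 \<le> t \<Longrightarrow> B t \<in> borel_measurable M"
  using B_adapted[of t t] filtration_measurable by auto

lemma N_measurable [measurable]: "0 \<le> t \<Longrightarrow> N t \<in> measurable M (count_space UNIV)"
  using N_adapted[of t t] filtration_measurable by auto

definition dB :: "real \<Rightarrow> real \<Rightarrow> 'm \<Rightarrow> 'a \<Rightarrow> real" where
  "dB s t i \<omega> = (B t \<omega> - B s \<omega>) $ i"

text \<open>The scheme subtracts in the reals, whereas \<open>poisson_process\<close> speaks of the
  truncated difference in \<open>nat\<close>. Monotone paths make the two agree almost surely, see
  \<open>dN_nat_diff\<close>.\<close>

definition dN :: "real \<Rightarrow> real \<Rightarrow> 'a \<Rightarrow> real" where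
  "dN s t \<omega> = real (N t \<omega>) - real (N s \<omega>)"

lemma dB_adapted:
  assumes "0 \<le> s" "s \<le> t" "t \<le> u" shows "dB s t i \<in> borel_measurable (\<F> u)"
proof -
  have [measurable]: "B s \<in> borel_measurable (\<F> u)" "B t \<in> borel_measurable (\<F> u)"
    using B_adapted[of s u] B_adapted[of t u] assms by auto
  show ?thesis unfolding dB_def [abs_def]
    by (rule measurable_compose[OF _ borel_measurable_nth]) measurable
qed

lemma dN_adapted:
  assumes "0 \<le> s" "s \<le> t" "t \<le> u" shows "dN s t \<in> borel_measurable (\<F> u)"
proof -
  have [measurable]: "N s \<in> measurable (\<F> u) (count_space UNIV)" "N t \<in> measurable (\<F> u) (count_space UNIV)"
    using N_adapted[of s u] N_adapted[of t u] assms by auto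
  show ?thesis unfolding dN_def [abs_def] by measurable
qed

lemma dB_measurable [measurable]: "0 \<le> s \<Longrightarrow> s \<le> t \<Longrightarrow> dB s t i \<in> borel_measurable M"
  by (rule filtration_measurable[OF _ dB_adapted[of s t t]]) auto

lemma dN_measurable [measurable]: "0 \<le> s \<Longrightarrow> s \<le> t \<Longrightarrow> dN s t \<in> borel_measurable M"
  by (rule filtration_measurable[OF _ dN_adapted[of s t t]]) auto

lemma dN_nat_diff:
  assumes "0 \<le> s" "s \<le> t" shows "AE \<omega> in M. dN s t \<omega> = real (N t \<omega> - N s \<omega>)"
proof -
  have "AE \<omega> in M. mono_on {0..} (\<lambda>t. N t \<omega>)" using poisson by (simp add: poisson_process_def)
  then show ?thesis
  proof eventually_elim
    case (elim \<omega>)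
    have "N s \<omega> \<le> N t \<omega>" by (rule mono_onD[OF elim]) (use assms in auto)
    then show ?case by (simp add: dN_def)
  qed
qed

text \<open>The density of the increment is a product over the coordinates, so the expectation
  reduces to one-dimensional Gaussian integrals.\<close>

lemma B_increment_moment:
  assumes st: "0 \<le> s" "s < t"
    and f: "\<And>i. has_bochner_integral lborel (\<lambda>x. normal_density 0 (sqrt (t - s)) x * f i x) (c i)"
    and [measurable]: "\<And>i. f i \<in> borel_measurable borel"
  shows "has_bochner_integral M (\<lambda>\<omega>. \<Prod>i\<in>UNIV. f i (dB s t i \<omega>)) (\<Prod>i\<in>UNIV. c i)"
proof -
  have D: "distributed M lborel (\<lambda>\<omega>. B t \<omega> - B s \<omega>)
      (\<lambda>z. ennreal (\<Prod>i\<in>UNIV. normal_density 0 (sqrt (t - s)) (z $ i)))"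
    using brownian st by (simp add: brownian_motion_def)
  have nn: "0 \<le> (\<Prod>i\<in>UNIV. normal_density 0 (sqrt (t - s)) (z $ i))" for z :: "real ^ 'm"
    by (intro prod_nonneg) simp
  have [measurable]: "(\<lambda>z :: real ^ 'm. \<Prod>i\<in>UNIV. f i (z $ i)) \<in> borel_measurable borel"
    by measurable
  have "has_bochner_integral lborel (\<lambda>z :: real ^ 'm.
      (\<Prod>i\<in>UNIV. normal_density 0 (sqrt (t - s)) (z $ i)) * (\<Prod>i\<in>UNIV. f i (z $ i))) (\<Prod>i\<in>UNIV. c i)"
    using has_bochner_integral_lborel_prod[OF f] by (simp add: prod.distrib)
  then show ?thesis
    using distributed_integral[OF D, of "\<lambda>z. \<Prod>i\<in>UNIV. f i (z $ i)"]
      distributed_integrable[OF D, of "\<lambda>z. \<Prod>i\<in>UNIV. f i (z $ i)"] nn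
    by (simp add: has_bochner_integral_iff dB_def)
qed

text \<open>Each monomial is written as a product over all coordinates, with factor 1 at those that
  do not occur. The fourth moment serves to control products of Brownian and Poisson
  increments.\<close>

lemma
  assumes st: "0 \<le> s" "s < t"
  shows dB_moment1: "has_bochner_integral M (dB s t i) 0"
    and dB_moment2: "has_bochner_integral M (\<lambda>\<omega>. dB s t i \<omega> * dB s t j \<omega>) (if i = j then t - s else 0)"
    and dB_moment4: "has_bochner_integral M (\<lambda>\<omega>. (dB s t i \<omega>) ^ 4) (3 * (t - s)\<^sup>2)"
proof -
  let ?\<sigma> = "sqrt (t - s)"
  have pos: "0 < ?\<sigma>" using st by simp
  have n0: "has_bochner_integral lborel (\<lambda>x. normal_density 0 ?\<sigma> x * 1) 1"
    using normal_moment_even[OF pos, of 0 0] by simp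
  have n1: "has_bochner_integral lborel (\<lambda>x. normal_density 0 ?\<sigma> x * x) 0"
    using normal_moment_odd[OF pos, of 0 0] by simp
  have n2: "has_bochner_integral lborel (\<lambda>x. normal_density 0 ?\<sigma> x * (x * x)) (t - s)"
    using normal_moment_even[OF pos, of 0 1] st by (simp add: power2_eq_square diff_divide_distrib)
  have n4: "has_bochner_integral lborel (\<lambda>x. normal_density 0 ?\<sigma> x * x ^ 4) (3 * (t - s)\<^sup>2)"
    using normal_moment_even[OF pos, of 0 2] st
    by (simp add: fact_numeral power_divide)
  have "has_bochner_integral M (\<lambda>\<omega>. \<Prod>k\<in>UNIV. if k = i then dB s t k \<omega> else 1)
      (\<Prod>k\<in>UNIV. if k = i then 0 else 1)"
    by (rule B_increment_moment[OF st, where f="\<lambda>k x. if k = i then x else 1"]) (use n0 n1 in auto)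
  then show "has_bochner_integral M (dB s t i) 0"
    by (simp add: prod.delta cong: if_cong)
  have "has_bochner_integral M (\<lambda>\<omega>. \<Prod>k\<in>UNIV. if k = i then (dB s t k \<omega>) ^ 4 else 1)
      (\<Prod>k\<in>UNIV. if k = i then 3 * (t - s)\<^sup>2 else 1)"
    by (rule B_increment_moment[OF st, where f="\<lambda>k x. if k = i then x ^ 4 else 1"]) (use n0 n4 in auto)
  then show "has_bochner_integral M (\<lambda>\<omega>. (dB s t i \<omega>) ^ 4) (3 * (t - s)\<^sup>2)"
    by (simp add: prod.delta cong: if_cong)
  have "has_bochner_integral M
      (\<lambda>\<omega>. \<Prod>k\<in>UNIV. (if k = i then dB s t k \<omega> else 1) * (if k = j then dB s t k \<omega> else 1))
      (\<Prod>k\<in>UNIV. if k = i then if i = j then t - s else 0 else if k = j then 0 else 1)"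
    by (rule B_increment_moment[OF st, where f="\<lambda>k x. (if k = i then x else 1) * (if k = j then x else 1)"])
       (use n0 n1 n2 in auto)
  \<comment> \<open>For \<open>i = j\<close> only the factor at \<open>i\<close> differs from 1; for
    \<open>i \<noteq> j\<close> the factor at \<open>i\<close> is the vanishing first
    moment.\<close>
  moreover have "(\<Prod>k\<in>UNIV. if k = i then if i = j then t - s else 0 else if k = j then 0 else 1)
      = (if i = j then t - s else 0)"
    proof (cases "i = j")
    case True
    then have "(if k = i then if i = j then t - s else 0 else if k = j then 0 else 1)
        = (if k = i then t - s else 1)" for k by simp
    then show ?thesis using True by (simp add: prod.delta)
  qed (auto intro!: prod_zero)
  ultimately show "has_bochner_integral M (\<lambda>\<omega>. dB s t i \<omega> * dB s t j \<omega>) (if i = j then t - s else 0)"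
    by (simp add: prod.distrib prod.delta cong: if_cong)
qed

lemma N_increment_moment:
  fixes f :: "real \<Rightarrow> real"
  assumes st: "0 \<le> s" "s < t" and [measurable]: "f \<in> borel_measurable borel"
    and f: "has_bochner_integral (measure_pmf (poisson_pmf (lam * (t - s)))) (\<lambda>n. f (real n)) c"
  shows "has_bochner_integral M (\<lambda>\<omega>. f (dN s t \<omega>)) c"
proof -
  have [measurable]: "N s \<in> measurable M (count_space UNIV)" "N t \<in> measurable M (count_space UNIV)"
    using N_measurable[of s] N_measurable[of t] st by auto
  have D: "distr M (count_space UNIV) (\<lambda>\<omega>. N t \<omega> - N s \<omega>) = measure_pmf (poisson_pmf (lam * (t - s)))"
    using poisson st by (simp add: poisson_process_def)
  have [measurable]: "(\<lambda>\<omega>. N t \<omega> - N s \<omega>) \<in> measurable M (count_space UNIV)"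
    by measurable
  have "has_bochner_integral M (\<lambda>\<omega>. f (real (N t \<omega> - N s \<omega>))) c"
    using f unfolding D[symmetric]
    by (simp add: has_bochner_integral_iff integrable_distr_eq integral_distr)
  moreover have "AE \<omega> in M. f (real (N t \<omega> - N s \<omega>)) = f (dN s t \<omega>)"
    using dN_nat_diff[of s t] st by auto
  moreover have "(\<lambda>\<omega>. f (dN s t \<omega>)) \<in> borel_measurable M"
    using dN_measurable[of s t] st by simp
  ultimately show ?thesis
    by (subst has_bochner_integral_cong_AE[symmetric]) auto
qed

lemma
  assumes st: "0 \<le> s" "s < t"
  shows dN_moment1: "has_bochner_integral M (dN s t) (lam * (t - s))"
    and dN_moment2: "has_bochner_integral M (\<lambda>\<omega>. (dN s t \<omega>)\<^sup>2) (lam * (t - s) + (lam * (t - s))\<^sup>2)"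
  using N_increment_moment[OF st, of "\<lambda>x. x"] N_increment_moment[OF st, of "\<lambda>x. x\<^sup>2"]
    poisson_moments[of "lam * (t - s)"] lam_pos st by auto

lemma adapted_times_dB:
  fixes \<xi> :: "'a \<Rightarrow> real"
  assumes st: "0 \<le> s" "s < t" and \<xi>: "\<xi> \<in> borel_measurable (\<F> s)" "integrable M \<xi>"
    and f: "f \<in> borel_measurable borel"
    and c: "has_bochner_integral M (\<lambda>\<omega>. f (B t \<omega> - B s \<omega>)) c"
  shows "has_bochner_integral M (\<lambda>\<omega>. \<xi> \<omega> * f (B t \<omega> - B s \<omega>)) (expectation \<xi> * c)"
proof (rule has_bochner_integral_indep_of[OF _ subalgebra_filtration \<xi> _ f])
  show "indep_of M (\<F> s) (\<lambda>\<omega>. B t \<omega> - B s \<omega>)" using brownian st by (simp add: brownian_motion_def)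
  show "(\<lambda>\<omega>. B t \<omega> - B s \<omega>) \<in> borel_measurable M" using st by simp
qed (use st c in auto)

text \<open>Independence from the past is given for the difference in \<open>nat\<close>, so the
  expectation is factored there, with \<open>f (real n)\<close> in place of \<open>f\<close>, and
  carried over to \<open>dN\<close> by almost sure equality.\<close>

lemma adapted_times_dN:
  fixes \<xi> :: "'a \<Rightarrow> real"
  assumes st: "0 \<le> s" "s < t" and \<xi>: "\<xi> \<in> borel_measurable (\<F> s)" "integrable M \<xi>"
    and f [measurable]: "f \<in> borel_measurable borel"
    and c: "has_bochner_integral M (\<lambda>\<omega>. f (dN s t \<omega>)) c"
  shows "has_bochner_integral M (\<lambda>\<omega>. \<xi> \<omega> * f (dN s t \<omega>)) (expectation \<xi> * c)"
proof -
  have [measurable]: "N s \<in> measurable M (count_space UNIV)" "N t \<in> measurable M (count_space UNIV)"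
    using N_measurable[of s] N_measurable[of t] st by auto
  have [measurable]: "(\<lambda>\<omega>. N t \<omega> - N s \<omega>) \<in> measurable M (count_space UNIV)"
    by measurable
  have [measurable]: "dN s t \<in> borel_measurable M" "\<xi> \<in> borel_measurable M"
    using st \<xi> by auto
  have AE: "AE \<omega> in M. dN s t \<omega> = real (N t \<omega> - N s \<omega>)" using dN_nat_diff st by auto
  have "has_bochner_integral M (\<lambda>\<omega>. \<xi> \<omega> * f (real (N t \<omega> - N s \<omega>))) (expectation \<xi> * c)"
  proof (rule has_bochner_integral_indep_of[OF _ subalgebra_filtration \<xi>, where f="\<lambda>n. f (real n)"])
    show "indep_of M (\<F> s) (\<lambda>\<omega>. N t \<omega> - N s \<omega>)" using poisson st by (simp add: poisson_process_def)
    show "(\<lambda>\<omega>. N t \<omega> - N s \<omega>) \<in> borel_measurable M"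
      by measurable
    show "has_bochner_integral M (\<lambda>\<omega>. f (real (N t \<omega> - N s \<omega>))) c"
      by (rule has_bochner_integral_cong_AE[THEN iffD1, OF _ _ _ c]) (use AE in auto)
    show "(\<lambda>n. f (real n)) \<in> borel_measurable borel"
      by (simp add: measurable_cong_sets[OF sets_borel_eq_count_space refl])
  qed (use st in auto)
  then show ?thesis
    by (rule has_bochner_integral_cong_AE[THEN iffD1, rotated -1]) (use AE in auto)
qed

end


section \<open>Mixed moments of Brownian and Poisson increments\<close>

text \<open>For small b the integrality of n helps, through n \<le> n^2; for |b| > \<eta> a Young
  inequality applies and b^2 \<le> b^4 / \<eta>^2. Over a time \<delta> the right side has mean
  O(\<delta>^2 / \<eta>^3 + \<eta> \<delta>), which can be made o(\<delta>), whereas Cauchy-Schwarz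
  would only give O(\<delta>).\<close>

lemma mult_le_pow4_plus_square:
  fixes b \<eta> :: real and n :: nat
  assumes "\<eta> > 0"
  shows "\<bar>b\<bar> * real n \<le> b ^ 4 / \<eta> ^ 3 + \<eta> * (real n)\<^sup>2"
proof (cases "\<bar>b\<bar> \<le> \<eta>")
  case True
  have "real n \<le> (real n)\<^sup>2" by (cases n) (auto simp: power2_eq_square)
  then have "\<bar>b\<bar> * real n \<le> \<eta> * (real n)\<^sup>2" using True by (intro mult_mono) auto
  moreover have "0 \<le> b ^ 4 / \<eta> ^ 3" using assms by simp
  ultimately show ?thesis by linarith
next
  case False
  then have "\<eta>\<^sup>2 * b\<^sup>2 \<le> b\<^sup>2 * b\<^sup>2"
    using assms by (intro mult_right_mono) (auto simp: power2_le_iff_abs_le abs_le_square_iff[symmetric])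
  then have "b\<^sup>2 / \<eta> \<le> b ^ 4 / \<eta> ^ 3"
    using assms by (simp add: field_simps power2_eq_square power3_eq_cube power4_eq_xxxx)
  moreover have "\<bar>b\<bar> * real n \<le> b\<^sup>2 / \<eta> + \<eta> * (real n)\<^sup>2"
  proof -
    have "0 \<le> (\<bar>b\<bar> - \<eta> * real n)\<^sup>2 + \<bar>b\<bar> * (\<eta> * real n)" using assms by simp
    then have "\<bar>b\<bar> * (\<eta> * real n) \<le> b\<^sup>2 + \<eta>\<^sup>2 * (real n)\<^sup>2"
      by (simp add: power2_eq_square algebra_simps)
    then have "(\<bar>b\<bar> * (\<eta> * real n)) / \<eta> \<le> (b\<^sup>2 + \<eta>\<^sup>2 * (real n)\<^sup>2) / \<eta>"
      using assms by (intro divide_right_mono) auto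
    then show ?thesis using assms by (simp add: add_divide_distrib power2_eq_square mult_ac)
  qed
  ultimately show ?thesis by linarith
qed

context jump_diffusion_noise
begin

context
  fixes \<xi> :: "'a \<Rightarrow> real" and s a b :: real
  assumes sab: "0 \<le> s" "s \<le> a" "a < b"
    and \<xi>: "\<xi> \<in> borel_measurable (\<F> s)" "integrable M \<xi>"
begin

lemma factor_adapted_later: "\<xi> \<in> borel_measurable (\<F> a)"
  using filtration_mono[OF _ _ \<xi>(1)] sab by auto

text \<open>The increment may start at a time \<open>a\<close> later than the time \<open>s\<close>
  at which \<open>\<xi>\<close> is known; this is what the pieces of a partition require.\<close>

lemma
  shows times_dB1: "has_bochner_integral M (\<lambda>\<omega>. \<xi> \<omega> * dB a b i \<omega>) 0"
    and times_dB2: "has_bochner_integral M (\<lambda>\<omega>. \<xi> \<omega> * (dB a b i \<omega> * dB a b j \<omega>))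
      (expectation \<xi> * (if i = j then b - a else 0))"
    and times_dB4: "has_bochner_integral M (\<lambda>\<omega>. \<xi> \<omega> * (dB a b i \<omega>) ^ 4)
      (expectation \<xi> * (3 * (b - a)\<^sup>2))"
    and times_dN1: "has_bochner_integral M (\<lambda>\<omega>. \<xi> \<omega> * dN a b \<omega>) (expectation \<xi> * (lam * (b - a)))"
    and times_dN2: "has_bochner_integral M (\<lambda>\<omega>. \<xi> \<omega> * (dN a b \<omega>)\<^sup>2)
      (expectation \<xi> * (lam * (b - a) + (lam * (b - a))\<^sup>2))"
proof -
  have ab: "0 \<le> a" "a < b" using sab by auto
  note dB = adapted_times_dB[OF ab factor_adapted_later \<xi>(2)] and dN = adapted_times_dN[OF ab factor_adapted_later \<xi>(2)]
  have nth: "(\<lambda>x::real^'m. x $ i) \<in> borel_measurable borel" for i by (rule borel_measurable_nth)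
  show "has_bochner_integral M (\<lambda>\<omega>. \<xi> \<omega> * dB a b i \<omega>) 0"
    using dB[of "\<lambda>x. x $ i" 0] dB_moment1[OF ab, of i] nth
    by (simp del: vector_minus_component add: dB_def [abs_def])
  show "has_bochner_integral M (\<lambda>\<omega>. \<xi> \<omega> * (dB a b i \<omega> * dB a b j \<omega>))
      (expectation \<xi> * (if i = j then b - a else 0))"
    using dB[of "\<lambda>x. x $ i * x $ j"] dB_moment2[OF ab, of i j] nth
    by (simp del: vector_minus_component add: dB_def [abs_def])
  show "has_bochner_integral M (\<lambda>\<omega>. \<xi> \<omega> * (dB a b i \<omega>) ^ 4) (expectation \<xi> * (3 * (b - a)\<^sup>2))"
    using dB[of "\<lambda>x. (x $ i) ^ 4"] dB_moment4[OF ab, of i] nth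
    by (simp del: vector_minus_component add: dB_def [abs_def])
  show "has_bochner_integral M (\<lambda>\<omega>. \<xi> \<omega> * dN a b \<omega>) (expectation \<xi> * (lam * (b - a)))"
    using dN[of "\<lambda>x. x"] dN_moment1[OF ab] by simp
  show "has_bochner_integral M (\<lambda>\<omega>. \<xi> \<omega> * (dN a b \<omega>)\<^sup>2)
      (expectation \<xi> * (lam * (b - a) + (lam * (b - a))\<^sup>2))"
    using dN[of "\<lambda>x. x\<^sup>2"] dN_moment2[OF ab] by simp
qed

end

text \<open>The earlier increment is absorbed into the adapted factor, and the later one is
  independent of the result. In either order the mean zero of the Brownian increment makes the
  expectation vanish.\<close>

lemma times_dB_dN_disjoint:
  fixes \<xi> :: "'a \<Rightarrow> real"
  assumes \<xi>: "0 \<le> s" "\<xi> \<in> borel_measurable (\<F> s)" "integrable M \<xi>"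
    and abcd: "s \<le> a" "a < b" "s \<le> c" "c < d" and disj: "b \<le> c \<or> d \<le> a"
  shows "has_bochner_integral M (\<lambda>\<omega>. \<xi> \<omega> * (dB a b i \<omega> * dN c d \<omega>)) 0"
  using disj
proof
  assume bc: "b \<le> c"
  have B: "has_bochner_integral M (\<lambda>\<omega>. \<xi> \<omega> * dB a b i \<omega>) 0"
    using times_dB1 \<xi> abcd by auto
  have m: "\<xi> \<in> borel_measurable (\<F> c)" "dB a b i \<in> borel_measurable (\<F> c)"
    using filtration_mono[OF _ _ \<xi>(2), of c] dB_adapted[of a b c] \<xi> abcd bc by auto
  have "has_bochner_integral M (\<lambda>\<omega>. (\<xi> \<omega> * dB a b i \<omega>) * dN c d \<omega>)
      (expectation (\<lambda>\<omega>. \<xi> \<omega> * dB a b i \<omega>) * (lam * (d - c)))"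
    by (rule times_dN1[of c c d]) (use \<xi> abcd m B in \<open>auto simp: has_bochner_integral_iff\<close>)
  then show ?thesis using B by (simp add: has_bochner_integral_iff mult.assoc)
next
  assume da: "d \<le> a"
  have N: "has_bochner_integral M (\<lambda>\<omega>. \<xi> \<omega> * dN c d \<omega>) (expectation \<xi> * (lam * (d - c)))"
    using times_dN1 \<xi> abcd by auto
  have m: "\<xi> \<in> borel_measurable (\<F> a)" "dN c d \<in> borel_measurable (\<F> a)"
    using filtration_mono[OF _ _ \<xi>(2), of a] dN_adapted[of c d a] \<xi> abcd da by auto
  have "has_bochner_integral M (\<lambda>\<omega>. (\<xi> \<omega> * dN c d \<omega>) * dB a b i \<omega>) 0"
    by (rule times_dB1[of a a b]) (use \<xi> abcd m N in \<open>auto simp: has_bochner_integral_iff\<close>)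
  then show ?thesis by (simp add: mult_ac)
qed

text \<open>Obtained by integrating \<open>mult_le_pow4_plus_square\<close> against |\<xi>|, which
  is again adapted. The parameter \<open>\<eta>\<close> stays free so that it can be tuned to the
  mesh of a partition.\<close>

lemma times_dB_dN_bound:
  fixes \<xi> :: "'a \<Rightarrow> real"
  assumes \<xi>: "0 \<le> s" "\<xi> \<in> borel_measurable (\<F> s)" "integrable M \<xi>"
    and ab: "s \<le> a" "a < b" and \<eta>: "\<eta> > 0"
  shows "integrable M (\<lambda>\<omega>. \<xi> \<omega> * (dB a b i \<omega> * dN a b \<omega>))" (is "integrable M ?f")
    and "\<bar>expectation (\<lambda>\<omega>. \<xi> \<omega> * (dB a b i \<omega> * dN a b \<omega>))\<bar> \<le> expectation (\<lambda>\<omega>. \<bar>\<xi> \<omega>\<bar>) *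
      (3 * (b - a)\<^sup>2 / \<eta> ^ 3 + \<eta> * (lam * (b - a) + (lam * (b - a))\<^sup>2))" (is "_ \<le> ?c")
proof -
  have [measurable]: "\<xi> \<in> borel_measurable M" "dB a b i \<in> borel_measurable M" "dN a b \<in> borel_measurable M"
    using \<xi> ab by auto
  have abs: "(\<lambda>\<omega>. \<bar>\<xi> \<omega>\<bar>) \<in> borel_measurable (\<F> s)" "integrable M (\<lambda>\<omega>. \<bar>\<xi> \<omega>\<bar>)"
    using \<xi> by auto
  let ?g = "\<lambda>\<omega>. (\<bar>\<xi> \<omega>\<bar> * (dB a b i \<omega>) ^ 4) * (1 / \<eta> ^ 3) + (\<bar>\<xi> \<omega>\<bar> * (dN a b \<omega>)\<^sup>2) * \<eta>"
  have g: "has_bochner_integral M ?g ((expectation (\<lambda>\<omega>. \<bar>\<xi> \<omega>\<bar>) * (3 * (b - a)\<^sup>2)) * (1 / \<eta> ^ 3)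
      + (expectation (\<lambda>\<omega>. \<bar>\<xi> \<omega>\<bar>) * (lam * (b - a) + (lam * (b - a))\<^sup>2)) * \<eta>)"
    by (intro has_bochner_integral_add has_bochner_integral_mult_left times_dB4[of s]
        times_dN2[of s] \<xi> ab abs)
  have le: "AE \<omega> in M. norm (?f \<omega>) \<le> ?g \<omega>"
    using dN_nat_diff[of a b, OF order_trans[OF \<xi>(1) ab(1)] less_imp_le[OF ab(2)]]
  proof eventually_elim
    case (elim \<omega>)
    have "norm (?f \<omega>) = \<bar>\<xi> \<omega>\<bar> * (\<bar>dB a b i \<omega>\<bar> * real (N b \<omega> - N a \<omega>))"
      by (simp add: elim abs_mult)
    also have "\<dots> \<le> \<bar>\<xi> \<omega>\<bar> * ((dB a b i \<omega>) ^ 4 / \<eta> ^ 3 + \<eta> * (real (N b \<omega> - N a \<omega>))\<^sup>2)"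
      by (intro mult_left_mono mult_le_pow4_plus_square \<eta>) auto
    finally show ?case by (simp add: elim algebra_simps)
  qed
  show int: "integrable M ?f"
    by (rule Bochner_Integration.integrable_bound[of _ ?g])
       (use g le in \<open>auto simp: has_bochner_integral_iff\<close>)
  have "\<bar>expectation ?f\<bar> \<le> expectation (\<lambda>\<omega>. norm (?f \<omega>))"
    using integral_norm_bound[of M ?f] by simp
  also have "\<dots> \<le> expectation ?g"
    by (rule integral_mono_AE) (use int g le in \<open>auto simp: has_bochner_integral_iff\<close>)
  also have "\<dots> = ?c" using g by (simp add: has_bochner_integral_iff algebra_simps)
  finally show "\<bar>expectation ?f\<bar> \<le> ?c" .
qed

lemma dB_partition:
  fixes u :: "nat \<Rightarrow> real"
  shows "dB (u 0) (u n) i \<omega> = (\<Sum>j<n. dB (u j) (u (Suc j)) i \<omega>)"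
  by (induction n) (auto simp: dB_def)

lemma dN_partition:
  fixes u :: "nat \<Rightarrow> real"
  shows "dN (u 0) (u n) \<omega> = (\<Sum>j<n. dN (u j) (u (Suc j)) \<omega>)"
  by (induction n) (auto simp: dN_def)

text \<open>Only the separate independence of the increments of \<open>B\<close> and of \<open>N\<close> from the past is available.
  Cut \<open>[s, t]\<close> into \<open>n\<close> pieces of length \<open>\<delta>\<close>: mixed products over different pieces have mean zero, as the
  earlier factor belongs to the past of the later one, while the products over a common piece have
  total mean \<open>O(n (\<delta>\<^sup>2 / \<eta>\<^sup>3 + \<eta> \<delta>))\<close>, which tends to zero for \<open>n = m\<^sup>4\<close> and \<open>\<eta> = 1 / m\<close>.\<close>

lemma times_dB_dN:
  fixes \<xi> :: "'a \<Rightarrow> real"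
  assumes \<xi>: "0 \<le> s" "\<xi> \<in> borel_measurable (\<F> s)" "integrable M \<xi>" and st: "s < t"
  shows "has_bochner_integral M (\<lambda>\<omega>. \<xi> \<omega> * (dB s t i \<omega> * dN s t \<omega>)) 0"
proof -
  let ?E = "expectation (\<lambda>\<omega>. \<xi> \<omega> * (dB s t i \<omega> * dN s t \<omega>))"
  define T where "T = t - s"
  define x where "x = expectation (\<lambda>\<omega>. \<bar>\<xi> \<omega>\<bar>)"
  define K where "K = 3 * T\<^sup>2 + lam * T + (lam * T)\<^sup>2"
  have T: "T > 0" using st by (simp add: T_def)
  have x: "x \<ge> 0" by (simp add: x_def)
  have bound: "\<bar>?E\<bar> \<le> x * K / real m" if m: "m > 0" for m :: nat
  proof -
    define n where "n = m ^ 4"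
    define \<delta> where "\<delta> = T / real n"
    define u where "u = (\<lambda>j. s + real j * \<delta>)"
    have n: "n > 0" using m by (simp add: n_def)
    have \<delta>: "\<delta> > 0" using T n by (simp add: \<delta>_def)
    have u0: "u 0 = s" and un: "u n = t" using n by (auto simp: u_def \<delta>_def T_def)
    have u_mono: "u j \<le> u k" if "j \<le> k" for j k
      using that \<delta> by (simp add: u_def mult_right_mono)
    have u_Suc: "u (Suc j) - u j = \<delta>" for j by (simp add: u_def algebra_simps)
    have u_less: "u j < u (Suc j)" for j using u_Suc[of j] \<delta> by linarith
    have u_ge: "s \<le> u j" for j using u_mono[of 0 j] u0 by simp
    define D where "D = (\<lambda>j k. expectation (\<lambda>\<omega>. \<xi> \<omega> * (dB (u j) (u (Suc j)) i \<omega> * dN (u k) (u (Suc k)) \<omega>)))"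
    have m1: "1 / real m > 0" using m by simp
    have diag: "integrable M (\<lambda>\<omega>. \<xi> \<omega> * (dB (u j) (u (Suc j)) i \<omega> * dN (u j) (u (Suc j)) \<omega>))"
      "\<bar>D j j\<bar> \<le> x * (3 * \<delta>\<^sup>2 / (1 / real m) ^ 3 + 1 / real m * (lam * \<delta> + (lam * \<delta>)\<^sup>2))" for j
      using times_dB_dN_bound[OF \<xi> u_ge u_less m1, of j i] unfolding u_Suc D_def x_def by auto
    have off: "has_bochner_integral M (\<lambda>\<omega>. \<xi> \<omega> * (dB (u j) (u (Suc j)) i \<omega> * dN (u k) (u (Suc k)) \<omega>)) 0"
      if "j \<noteq> k" for j k
      using that u_mono[of "Suc j" k] u_mono[of "Suc k" j]
      by (intro times_dB_dN_disjoint[OF \<xi> u_ge u_less u_ge u_less]) linarith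
    have hbi: "has_bochner_integral M
        (\<lambda>\<omega>. \<xi> \<omega> * (dB (u j) (u (Suc j)) i \<omega> * dN (u k) (u (Suc k)) \<omega>)) (if j = k then D j j else 0)" for j k
      using diag(1)[of j] off[of j k] by (auto simp: has_bochner_integral_iff D_def)
    have "has_bochner_integral M (\<lambda>\<omega>. \<Sum>j<n. \<Sum>k<n.
        \<xi> \<omega> * (dB (u j) (u (Suc j)) i \<omega> * dN (u k) (u (Suc k)) \<omega>)) (\<Sum>j<n. \<Sum>k<n. if j = k then D j j else 0)"
      by (intro has_bochner_integral_sum hbi)
    moreover have "(\<Sum>j<n. \<Sum>k<n. if j = k then D j j else 0) = (\<Sum>j<n. D j j)"
      by simp
    moreover have "(\<Sum>j<n. \<Sum>k<n. \<xi> \<omega> * (dB (u j) (u (Suc j)) i \<omega> * dN (u k) (u (Suc k)) \<omega>))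
        = \<xi> \<omega> * (dB s t i \<omega> * dN s t \<omega>)" for \<omega>
      using dB_partition[of u n i \<omega>] dN_partition[of u n \<omega>]
      by (simp add: u0 un sum_product) (simp add: sum_distrib_left)
    ultimately have "?E = (\<Sum>j<n. D j j)"
      by (simp add: has_bochner_integral_iff)
    also have "\<bar>\<dots>\<bar> \<le> (\<Sum>j<n. x * (3 * \<delta>\<^sup>2 / (1 / real m) ^ 3 + 1 / real m * (lam * \<delta> + (lam * \<delta>)\<^sup>2)))"
      by (intro order_trans[OF sum_abs] sum_mono diag(2))
    \<comment> \<open>With \<delta> = T / m^4 and \<eta> = 1 / m, the n = m^4 equal terms give n
      \<delta>^2 m^3 = T^2 / m and n \<delta> / m = T / m, while the quadratic Poisson part keeps an
      extra factor 1 / n.\<close>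
    also have "\<dots> = x * (3 * T\<^sup>2 / real m + 1 / real m * (lam * T + (lam * T)\<^sup>2 / real n))"
      using m n by (simp add: \<delta>_def power_divide power_mult_distrib)
        (simp add: n_def field_simps power2_eq_square power3_eq_cube power4_eq_xxxx)
    also have "\<dots> \<le> x * (3 * T\<^sup>2 / real m + 1 / real m * (lam * T + (lam * T)\<^sup>2))"
      using n x by (intro mult_left_mono add_left_mono) (auto simp: divide_le_eq mult_le_cancel_left1)
    also have "\<dots> = x * K / real m" by (simp add: K_def field_simps add_divide_distrib)
    finally show ?thesis .
  qed
  have "\<bar>?E\<bar> \<le> 0"
  \<comment> \<open>\<open>?E\<close> does not depend on \<open>m\<close>, so \<open>m\<close> may
    tend to infinity in the bound.\<close>
  proof (rule LIMSEQ_le_const)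
    show "(\<lambda>m. x * K / real m) \<longlonglongrightarrow> 0" by (rule lim_const_over_n)
    show "\<exists>m0. \<forall>m\<ge>m0. \<bar>?E\<bar> \<le> x * K / real m" using bound by (intro exI[of _ 1]) auto
  qed
  moreover have "integrable M (\<lambda>\<omega>. \<xi> \<omega> * (dB s t i \<omega> * dN s t \<omega>))"
    using times_dB_dN_bound(1)[OF \<xi> order_refl st, of 1] by simp
  ultimately show ?thesis by (simp add: has_bochner_integral_iff)
qed

end

section \<open>Second moment of one step\<close>


text \<open>Lets the noise term be expanded as a sum of columns weighted by the coordinates of the
  Brownian increment, whose variances then add up to the trace norm.\<close>

lemma norm_matrix_eq_sum_columns:
  fixes A :: "real ^ 'm ^ 'd"
  shows "(norm A)\<^sup>2 = (\<Sum>j\<in>UNIV. (norm (column j A))\<^sup>2)"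
proof -
  have "(norm A)\<^sup>2 = (\<Sum>i\<in>UNIV. \<Sum>j\<in>UNIV. (A $ i $ j)\<^sup>2)"
    by (simp add: norm_vec_def L2_set_def sum_nonneg)
  also have "\<dots> = (\<Sum>j\<in>UNIV. \<Sum>i\<in>UNIV. (A $ i $ j)\<^sup>2)" by (rule sum.swap)
  finally show ?thesis by (simp add: column_def norm_vec_def L2_set_def sum_nonneg)
qed

lemma norm_column_le:
  fixes A :: "real ^ 'm ^ 'd"
  shows "(norm (column j A))\<^sup>2 \<le> (norm A)\<^sup>2"
  unfolding norm_matrix_eq_sum_columns by (rule member_le_sum) auto

lemma borel_measurable_column: "(column j :: real ^ 'm ^ 'd \<Rightarrow> _) \<in> borel_measurable borel"
  unfolding column_def [abs_def] by (intro borel_measurable_continuous_onI continuous_intros)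

lemma matrix_vector_mult_columns:
  fixes A :: "real ^ 'm ^ 'd"
  shows "A *v w = (\<Sum>j\<in>UNIV. w $ j *\<^sub>R column j A)"
  by (simp add: matrix_mult_sum scalar_mult_eq_scaleR)

lemma integrable_inner_square_integrable:
  fixes X Y :: "'a \<Rightarrow> 'b :: euclidean_space"
  assumes [measurable]: "X \<in> borel_measurable M" "Y \<in> borel_measurable M"
    and XY: "integrable M (\<lambda>\<omega>. (norm (X \<omega>))\<^sup>2)" "integrable M (\<lambda>\<omega>. (norm (Y \<omega>))\<^sup>2)"
  shows "integrable M (\<lambda>\<omega>. X \<omega> \<bullet> Y \<omega>)"
proof (rule Bochner_Integration.integrable_bound)
  show "integrable M (\<lambda>\<omega>. (norm (X \<omega>))\<^sup>2 + (norm (Y \<omega>))\<^sup>2)" using XY by simp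
  show "AE \<omega> in M. norm (X \<omega> \<bullet> Y \<omega>) \<le> norm ((norm (X \<omega>))\<^sup>2 + (norm (Y \<omega>))\<^sup>2)"
  proof (rule AE_I2)
    fix \<omega>
    have "norm (X \<omega> \<bullet> Y \<omega>) \<le> norm (X \<omega>) * norm (Y \<omega>)" by (simp add: Cauchy_Schwarz_ineq2)
    also have "\<dots> \<le> 2 * norm (X \<omega>) * norm (Y \<omega>)" by simp
    also have "\<dots> \<le> (norm (X \<omega>))\<^sup>2 + (norm (Y \<omega>))\<^sup>2" by (rule sum_squares_bound)
    finally show "norm (X \<omega> \<bullet> Y \<omega>) \<le> norm ((norm (X \<omega>))\<^sup>2 + (norm (Y \<omega>))\<^sup>2)" by simp
  qed
qed measurable

context jump_diffusion_noise
begin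

text \<open>The square expands into monomials in \<open>dB\<close> and \<open>dN\<close> with
  coefficients known at time \<open>s\<close>, so every term has a computed mean. Here
  \<open>a\<close> stands for the part of the step known at time \<open>s\<close>, that is X +
  \<Delta> f.\<close>

lemma increment_second_moment:
  fixes a h :: "'a \<Rightarrow> real ^ 'd" and g :: "'a \<Rightarrow> real ^ 'm ^ 'd"
  assumes st: "0 \<le> s" "s < t"
    and a: "a \<in> borel_measurable (\<F> s)" "integrable M (\<lambda>\<omega>. (norm (a \<omega>))\<^sup>2)"
    and g: "g \<in> borel_measurable (\<F> s)" "integrable M (\<lambda>\<omega>. (norm (g \<omega>))\<^sup>2)"
    and h: "h \<in> borel_measurable (\<F> s)" "integrable M (\<lambda>\<omega>. (norm (h \<omega>))\<^sup>2)"
  shows "has_bochner_integral M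
      (\<lambda>\<omega>. (norm (a \<omega> + g \<omega> *v (B t \<omega> - B s \<omega>) + dN s t \<omega> *\<^sub>R h \<omega>))\<^sup>2)
      (expectation (\<lambda>\<omega>. (norm (a \<omega>))\<^sup>2) + (t - s) * expectation (\<lambda>\<omega>. (norm (g \<omega>))\<^sup>2)
       + (lam * (t - s) + (lam * (t - s))\<^sup>2) * expectation (\<lambda>\<omega>. (norm (h \<omega>))\<^sup>2)
       + 2 * (lam * (t - s)) * expectation (\<lambda>\<omega>. a \<omega> \<bullet> h \<omega>))"
proof -
  define c where "c = (\<lambda>j \<omega>. column j (g \<omega>))"
  have c: "c j \<in> borel_measurable (\<F> s)" "integrable M (\<lambda>\<omega>. (norm (c j \<omega>))\<^sup>2)" for j
  proof -
    show m: "c j \<in> borel_measurable (\<F> s)"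
      unfolding c_def by (rule measurable_compose[OF g(1) borel_measurable_column])
    have [measurable]: "c j \<in> borel_measurable M"
      using m st(1) filtration_measurable by blast
    show "integrable M (\<lambda>\<omega>. (norm (c j \<omega>))\<^sup>2)"
    proof (rule Bochner_Integration.integrable_bound[OF g(2)])
      show "(\<lambda>\<omega>. (norm (c j \<omega>))\<^sup>2) \<in> borel_measurable M"
        by (intro borel_measurable_power measurable_compose[OF _ borel_measurable_norm]) fact
      show "AE \<omega> in M. norm ((norm (c j \<omega>))\<^sup>2) \<le> norm ((norm (g \<omega>))\<^sup>2)"
        using norm_column_le by (intro AE_I2) (simp add: c_def)
    qed
  qed
  have inner: "(\<lambda>\<omega>. X \<omega> \<bullet> Y \<omega>) \<in> borel_measurable (\<F> s)" "integrable M (\<lambda>\<omega>. X \<omega> \<bullet> Y \<omega>)"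
    if X: "X \<in> borel_measurable (\<F> s)" "integrable M (\<lambda>\<omega>. (norm (X \<omega>))\<^sup>2)"
      and Y: "Y \<in> borel_measurable (\<F> s)" "integrable M (\<lambda>\<omega>. (norm (Y \<omega>))\<^sup>2)"
    for X Y :: "'a \<Rightarrow> real ^ 'd"
  proof -
    show "(\<lambda>\<omega>. X \<omega> \<bullet> Y \<omega>) \<in> borel_measurable (\<F> s)"
      by (rule borel_measurable_inner[OF X(1) Y(1)])
    show "integrable M (\<lambda>\<omega>. X \<omega> \<bullet> Y \<omega>)"
      by (rule integrable_inner_square_integrable[OF filtration_measurable[OF st(1) X(1)]
          filtration_measurable[OF st(1) Y(1)] X(2) Y(2)])
  qed
  note ss = st(1) order_refl[of s] st(2)
  note ints = times_dB1[OF ss inner[OF a c]] times_dB2[OF ss inner[OF c c]]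
    times_dN1[OF ss inner[OF a h]] times_dN2[OF ss inner[OF h h]]
    times_dB_dN[OF st(1) inner[OF h c] st(2)]
  let ?V = "\<lambda>\<omega>. a \<omega> + g \<omega> *v (B t \<omega> - B s \<omega>) + dN s t \<omega> *\<^sub>R h \<omega>"
  have expand: "(norm (?V \<omega>))\<^sup>2 = a \<omega> \<bullet> a \<omega>
      + (\<Sum>j\<in>UNIV. \<Sum>k\<in>UNIV. (c j \<omega> \<bullet> c k \<omega>) * (dB s t j \<omega> * dB s t k \<omega>))
      + (h \<omega> \<bullet> h \<omega>) * (dN s t \<omega>)\<^sup>2
      + 2 * (\<Sum>j\<in>UNIV. (a \<omega> \<bullet> c j \<omega>) * dB s t j \<omega>)
      + 2 * ((a \<omega> \<bullet> h \<omega>) * dN s t \<omega>)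
      + 2 * (\<Sum>j\<in>UNIV. (h \<omega> \<bullet> c j \<omega>) * (dB s t j \<omega> * dN s t \<omega>))" for \<omega>
  proof -
    define b where "b = g \<omega> *v (B t \<omega> - B s \<omega>)"
    have b: "b = (\<Sum>j\<in>UNIV. dB s t j \<omega> *\<^sub>R c j \<omega>)"
      by (simp only: b_def matrix_vector_mult_columns dB_def c_def)
    have "b \<bullet> b = (\<Sum>j\<in>UNIV. \<Sum>k\<in>UNIV. (c j \<omega> \<bullet> c k \<omega>) * (dB s t j \<omega> * dB s t k \<omega>))"
      unfolding b by (simp add: inner_sum_left inner_sum_right mult_ac inner_commute)
    moreover have "a \<omega> \<bullet> b = (\<Sum>j\<in>UNIV. (a \<omega> \<bullet> c j \<omega>) * dB s t j \<omega>)"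
      unfolding b by (simp add: inner_sum_right mult_ac)
    moreover have "dN s t \<omega> * (h \<omega> \<bullet> b) = (\<Sum>j\<in>UNIV. (h \<omega> \<bullet> c j \<omega>) * (dB s t j \<omega> * dN s t \<omega>))"
      unfolding b by (simp add: inner_sum_right sum_distrib_left mult_ac)
    moreover have "(norm (?V \<omega>))\<^sup>2 = a \<omega> \<bullet> a \<omega> + b \<bullet> b + (h \<omega> \<bullet> h \<omega>) * (dN s t \<omega>)\<^sup>2
        + 2 * (a \<omega> \<bullet> b) + 2 * ((a \<omega> \<bullet> h \<omega>) * dN s t \<omega>) + 2 * (dN s t \<omega> * (h \<omega> \<bullet> b))"
      unfolding power2_norm_eq_inner b_def[symmetric]
      by (simp add: inner_add_left inner_add_right inner_commute power2_eq_square algebra_simps)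
    ultimately show ?thesis by simp
  qed
  \<comment> \<open>The summands follow the order of \<open>expand\<close>; the two sums of zeros
    are the means of the terms linear in \<open>dB\<close> and of the mixed products.\<close>
  let ?E = "expectation (\<lambda>\<omega>. a \<omega> \<bullet> a \<omega>)
      + (\<Sum>j\<in>UNIV. \<Sum>k\<in>UNIV. expectation (\<lambda>\<omega>. c j \<omega> \<bullet> c k \<omega>) * (if j = k then t - s else 0))
      + expectation (\<lambda>\<omega>. h \<omega> \<bullet> h \<omega>) * (lam * (t - s) + (lam * (t - s))\<^sup>2)
      + 2 * (\<Sum>j\<in>(UNIV :: 'm set). 0) + 2 * (expectation (\<lambda>\<omega>. a \<omega> \<bullet> h \<omega>) * (lam * (t - s)))
      + 2 * (\<Sum>j\<in>(UNIV :: 'm set). 0)"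
  have V: "has_bochner_integral M (\<lambda>\<omega>. (norm (?V \<omega>))\<^sup>2) ?E"
    unfolding expand
    by (intro has_bochner_integral_add has_bochner_integral_sum has_bochner_integral_mult_right
        ints has_bochner_integral_integrable inner(2) a)
  \<comment> \<open>Distinct coordinates are uncorrelated, so only the squared column norms survive
    and recombine to the trace norm of \<open>g\<close>.\<close>
  have diag: "(\<Sum>j\<in>UNIV. \<Sum>k\<in>UNIV. expectation (\<lambda>\<omega>. c j \<omega> \<bullet> c k \<omega>) * (if j = k then t - s else 0))
      = (t - s) * expectation (\<lambda>\<omega>. (norm (g \<omega>))\<^sup>2)"
  proof -
    have "(\<Sum>j\<in>UNIV. \<Sum>k\<in>UNIV. expectation (\<lambda>\<omega>. c j \<omega> \<bullet> c k \<omega>) * (if j = k then t - s else 0))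
      = (\<Sum>j\<in>UNIV. expectation (\<lambda>\<omega>. (norm (c j \<omega>))\<^sup>2) * (t - s))"
      by (simp add: if_distrib[of "\<lambda>x. _ * x"] dot_square_norm cong: if_cong)
    also have "\<dots> = (t - s) * expectation (\<lambda>\<omega>. \<Sum>j\<in>UNIV. (norm (c j \<omega>))\<^sup>2)"
      by (subst Bochner_Integration.integral_sum) (auto simp: c sum_distrib_left mult_ac)
    finally show ?thesis by (simp add: norm_matrix_eq_sum_columns c_def)
  qed
  show ?thesis
    by (rule has_bochner_integral_cong[THEN iffD1, OF refl refl _ V], unfold diag)
       (simp add: dot_square_norm algebra_simps)
qed

end

section \<open>Truncated coefficients\<close>


lemma npow_mono: "0 \<le> r \<Longrightarrow> r \<le> r' \<Longrightarrow> 0 \<le> a \<Longrightarrow> npow r a \<le> npow r' a"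
  by (simp add: npow_def powr_mono2)

lemma npow_le_one: "0 \<le> r \<Longrightarrow> r \<le> 1 \<Longrightarrow> 0 \<le> a \<Longrightarrow> npow r a \<le> 1"
  by (simp add: npow_def powr_le1)

text \<open>On the unit ball around y the Lipschitz factor is bounded by a constant. Continuity is
  used for the Borel measurability of the coefficients.\<close>

lemma continuous_on_poly_Lipschitz:
  fixes F :: "'b :: real_normed_vector \<Rightarrow> 'c :: real_normed_vector"
  assumes "L \<ge> 0" "\<gamma> \<ge> 0"
    and F: "\<And>x y. norm (F x - F y) \<le> L * (1 + npow (norm x) \<gamma> + npow (norm y) \<gamma>) * norm (x - y)"
  shows "continuous_on UNIV F"
proof -
  have "isCont F y" for y
  proof -
    define c where "c = L * (1 + npow (norm y + 1) \<gamma> + npow (norm y) \<gamma>)"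
    have "(F \<longlongrightarrow> F y) (at y)"
    proof (rule Lim_transform_bound[of _ "\<lambda>x. c * norm (x - y)", THEN Lim_null[THEN iffD2]])
      show "((\<lambda>x. c * norm (x - y)) \<longlongrightarrow> 0) (at y)" by (auto intro!: tendsto_eq_intros)
      have "\<forall>\<^sub>F x in at y. dist x y < 1" by (auto simp: eventually_at intro: exI[of _ 1])
      then show "\<forall>\<^sub>F x in at y. norm (F x - F y) \<le> norm (c * norm (x - y))"
      proof eventually_elim
        case (elim x)
        have "norm x \<le> norm y + 1" using elim norm_triangle_ineq2[of x y] by (simp add: dist_norm)
        then have "L * (1 + npow (norm x) \<gamma> + npow (norm y) \<gamma>) * norm (x - y) \<le> c * norm (x - y)"
          unfolding c_def using assms npow_mono[of "norm x" "norm y + 1" \<gamma>]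
          by (intro mult_right_mono mult_left_mono) auto
        then show ?case using F[of x y] by (intro order_trans[OF F]) auto
      qed
    qed
    then show ?thesis by (simp add: isCont_def)
  qed
  then show ?thesis by (simp add: continuous_at_imp_continuous_on)
qed

lemma \<mu>_inv_range:
  assumes "y \<in> \<mu> ` {0..}"
  shows "0 \<le> \<mu>_inv \<mu> y" "\<mu> (\<mu>_inv \<mu> y) = y"
  using inv_into_into[OF assms] f_inv_into_f[OF assms] by (auto simp: \<mu>_inv_def)

lemma norm_trunc_proj:
  assumes "\<phi> \<Delta> \<in> \<mu> ` {0..}"
  shows "norm (trunc_proj \<mu> \<phi> \<Delta> x) = min (norm x) (\<mu>_inv \<mu> (\<phi> \<Delta>))"
  using \<mu>_inv_range(1)[OF assms]
  by (cases "x = 0") (auto simp: trunc_proj_def norm_sgn)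

lemma borel_measurable_trunc_proj: "trunc_proj \<mu> \<phi> \<Delta> \<in> borel_measurable borel"
  unfolding trunc_proj_def [abs_def] sgn_div_norm by measurable

text \<open>Outside the truncation radius \<open>x\<close> is a multiple \<open>c \<ge> 1\<close> of its projection \<open>y\<close>; then
  \<open>c |y|\<^sup>2 \<le> |x|\<^sup>2\<close>, while the nonnegative term in \<open>G\<close> only grows when multiplied by \<open>c\<close>.\<close>

lemma trunc_dissipative:
  assumes range: "\<phi> \<Delta> \<in> \<mu> ` {0..}" and "F 0 = 0" "G 0 = 0" and \<kappa>: "\<kappa> \<ge> 0" and \<alpha>: "\<alpha> \<ge> 0"
    and diss: "\<And>x. 2 * (x \<bullet> F x) + \<kappa> * (norm (G x))\<^sup>2 \<le> \<alpha> * (norm x)\<^sup>2"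
  shows "2 * (x \<bullet> F (trunc_proj \<mu> \<phi> \<Delta> x)) + \<kappa> * (norm (G (trunc_proj \<mu> \<phi> \<Delta> x)))\<^sup>2 \<le> \<alpha> * (norm x)\<^sup>2"
proof -
  define R where "R = \<mu>_inv \<mu> (\<phi> \<Delta>)"
  define y where "y = trunc_proj \<mu> \<phi> \<Delta> x"
  have R: "R \<ge> 0" using \<mu>_inv_range(1)[OF range] by (simp add: R_def)
  have y: "y = min (norm x) R *\<^sub>R sgn x" by (simp add: y_def R_def trunc_proj_def)
  consider "norm x \<le> R" | "R = 0" | "0 < R" "R < norm x" using R by linarith
  then have "2 * (x \<bullet> F y) + \<kappa> * (norm (G y))\<^sup>2 \<le> \<alpha> * (norm x)\<^sup>2"
  proof cases
    case 1
    then have "y = x" by (cases "x = 0") (simp_all add: y sgn_div_norm)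
    then show ?thesis using diss by simp
  next
    \<comment> \<open>The truncation radius may be 0; the projection is then 0, where
      \<open>F\<close> and \<open>G\<close> vanish.\<close>
    case 2
    then have "y = 0" by (simp add: y)
    then show ?thesis using assms by simp
  next
    case 3
    define c where "c = norm x / R"
    have c: "c \<ge> 1" and x: "x = c *\<^sub>R y" and ny: "norm y = R"
      using 3 by (auto simp: c_def y sgn_div_norm divide_simps)
    have "2 * (x \<bullet> F y) + \<kappa> * (norm (G y))\<^sup>2 \<le> c * (2 * (y \<bullet> F y)) + c * (\<kappa> * (norm (G y))\<^sup>2)"
      using c \<kappa> mult_right_mono[of 1 c "\<kappa> * (norm (G y))\<^sup>2"] by (subst x) auto
    also have "\<dots> \<le> c * (\<alpha> * (norm y)\<^sup>2)"
      using mult_left_mono[OF diss[of y], of c] c by (simp add: algebra_simps)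
    also have "\<dots> = \<alpha> * (norm x * R)" using 3 by (simp add: ny c_def power2_eq_square)
    also have "\<dots> \<le> \<alpha> * (norm x)\<^sup>2"
      using 3 \<alpha> by (simp add: power2_eq_square mult_left_mono)
    finally show ?thesis .
  qed
  then show ?thesis by (simp add: y_def)
qed

text \<open>A projection y with |y| \<le> 1 is handled by the Lipschitz condition against 0, whose
  bracket is at most 3. If |y| > 1, then the radius and |x| both exceed 1, so the bound
  \<phi>(\<Delta>) on the truncated ball is at most \<phi>(\<Delta>) |x|. A bound proportional to
  |x| is needed for decay to 0.\<close>

lemma trunc_linear_growth:
  assumes range: "\<phi> \<Delta> \<in> \<mu> ` {0..}" and "\<phi> \<Delta> \<ge> 0" and "H 0 = 0" and L: "L \<ge> 0" "\<gamma> \<ge> 0"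
    and H: "\<And>x y. norm (H x - H y) \<le> L * (1 + npow (norm x) \<gamma> + npow (norm y) \<gamma>) * norm (x - y)"
    and growth: "\<And>n x. n \<ge> 1 \<Longrightarrow> norm x \<le> n \<Longrightarrow> norm (H x) \<le> \<mu> n"
  shows "norm (H (trunc_proj \<mu> \<phi> \<Delta> x)) \<le> (3 * L + \<phi> \<Delta>) * norm x"
proof -
  define R where "R = \<mu>_inv \<mu> (\<phi> \<Delta>)"
  define y where "y = trunc_proj \<mu> \<phi> \<Delta> x"
  have R: "\<mu> R = \<phi> \<Delta>" using \<mu>_inv_range(2)[OF range] by (simp add: R_def)
  have y: "norm y = min (norm x) R" using norm_trunc_proj[where \<phi>=\<phi> and \<Delta>=\<Delta> and x=x, OF range] by (simp add: y_def R_def)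
  have "norm (H y) \<le> (3 * L + \<phi> \<Delta>) * norm x"
  proof (cases "norm y \<le> 1")
    case True
    have "norm (H y) \<le> L * (1 + npow (norm y) \<gamma> + npow (norm (0 :: 'a)) \<gamma>) * norm y"
      using H[of y 0] \<open>H 0 = 0\<close> by simp
    also have "\<dots> \<le> L * (1 + 1 + 1) * norm x"
    proof (intro mult_mono mult_left_mono add_mono order_refl)
      show "npow (norm y) \<gamma> \<le> 1" "npow (norm (0 :: 'a)) \<gamma> \<le> 1"
        using True L npow_le_one by auto
      show "norm y \<le> norm x" by (simp add: y)
    qed (use L in \<open>auto simp: npow_def\<close>)
    also have "\<dots> \<le> (3 * L + \<phi> \<Delta>) * norm x" using assms by (intro mult_right_mono) auto
    finally show ?thesis .
  next
    case False
    \<comment> \<open>The growth bound is taken at n = R, which is admissible because R \<ge> |y| >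
      1, and \<open>\<mu> R = \<phi> \<Delta>\<close>.\<close>
    then have "norm (H y) \<le> \<phi> \<Delta>" using growth[of R y] y R by auto
    also have "\<dots> \<le> \<phi> \<Delta> * norm x" using False y mult_left_mono[of 1 "norm x" "\<phi> \<Delta>"] \<open>\<phi> \<Delta> \<ge> 0\<close> by auto
    also have "\<dots> \<le> (3 * L + \<phi> \<Delta>) * norm x" using L by (intro mult_right_mono) auto
    finally show ?thesis .
  qed
  then show ?thesis by (simp add: y_def)
qed

section \<open>Real dissipativity constants and the choice of the step size\<close>

text \<open>Replaces the extended real \<theta> by the real weights \<kappa>1 = 1 + \<theta> and
  \<kappa>2 = 1 + 1/\<theta>, for which Young's inequality bounds |G1 + G|^2. This bound allows two
  different points, since \<open>G\<close> will be evaluated at the projection of the argument of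
  \<open>G1\<close>.\<close>

lemma dissipative_splitE:
  assumes "dissipative_split F1 F G1 G \<alpha>1 \<alpha>2 \<theta>"
  obtains \<kappa>1 \<kappa>2 :: real where "\<kappa>1 \<ge> 0" "\<kappa>2 \<ge> 0"
    "\<And>x. 2 * (x \<bullet> F1 x) + \<kappa>1 * (norm (G1 x))\<^sup>2 \<le> - \<alpha>1 * (norm x)\<^sup>2"
    "\<And>x. 2 * (x \<bullet> F x) + \<kappa>2 * (norm (G x))\<^sup>2 \<le> \<alpha>2 * (norm x)\<^sup>2"
    "\<And>x y. (norm (G1 x + G y))\<^sup>2 \<le> \<kappa>1 * (norm (G1 x))\<^sup>2 + \<kappa>2 * (norm (G y))\<^sup>2"
proof -
  have lin: "ereal (2 * (x \<bullet> F1 x)) + (1 + \<theta>) * ereal ((norm (G1 x))\<^sup>2) \<le> ereal (- \<alpha>1 * (norm x)\<^sup>2)"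
    and super: "ereal (2 * (x \<bullet> F x)) + (1 + inverse \<theta>) * ereal ((norm (G x))\<^sup>2) \<le> ereal (\<alpha>2 * (norm x)\<^sup>2)"
    for x
    using assms unfolding dissipative_split_def by blast+
  from assms consider r where "\<theta> = ereal r" "r > 0"
    | "\<theta> = 0" "\<And>x. G x = 0" | "\<theta> = \<infinity>" "\<And>x. G1 x = 0"
    unfolding dissipative_split_def by (cases \<theta>) auto
  then show thesis
  proof cases
    case 1
    have young: "(norm (u + v))\<^sup>2 \<le> (1 + r) * (norm u)\<^sup>2 + (1 + 1 / r) * (norm v)\<^sup>2" for u v :: "real ^ 'b ^ 'a"
    proof -
      have "0 \<le> (r * norm u - norm v)\<^sup>2 / r" using \<open>r > 0\<close> by simp
      also have "\<dots> = r * (norm u)\<^sup>2 + (1 / r) * (norm v)\<^sup>2 - 2 * norm u * norm v"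
        using \<open>r > 0\<close> by (simp add: field_simps power2_eq_square)
      finally have "2 * norm u * norm v \<le> r * (norm u)\<^sup>2 + (1 / r) * (norm v)\<^sup>2" by simp
      moreover have "(norm (u + v))\<^sup>2 \<le> (norm u + norm v)\<^sup>2"
        by (intro power_mono norm_triangle_ineq) auto
      ultimately show ?thesis by (simp add: power2_sum algebra_simps)
    qed
    show thesis
    proof (rule that[of "1 + r" "1 + 1 / r"])
      show "2 * (x \<bullet> F1 x) + (1 + r) * (norm (G1 x))\<^sup>2 \<le> - \<alpha>1 * (norm x)\<^sup>2" for x
        using lin[of x] by (simp add: \<open>\<theta> = ereal r\<close> one_ereal_def)
      show "2 * (x \<bullet> F x) + (1 + 1 / r) * (norm (G x))\<^sup>2 \<le> \<alpha>2 * (norm x)\<^sup>2" for x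
        using super[of x] \<open>r > 0\<close> by (simp add: \<open>\<theta> = ereal r\<close> one_ereal_def inverse_eq_divide)
    qed (use \<open>r > 0\<close> young in auto)
  next
    case 2
    show thesis
    \<comment> \<open>Here the infinite weight 1 + 1/\<theta> multiplies \<open>G x = 0\<close>, so
      it may be replaced by 0; the case \<theta> = \<infinity> is symmetric, with \<open>G1\<close>
      absent.\<close>
    proof (rule that[of 1 0])
      show "2 * (x \<bullet> F1 x) + 1 * (norm (G1 x))\<^sup>2 \<le> - \<alpha>1 * (norm x)\<^sup>2" for x
        using lin[of x] by (simp add: 2(1))
      show "2 * (x \<bullet> F x) + 0 * (norm (G x))\<^sup>2 \<le> \<alpha>2 * (norm x)\<^sup>2" for x
        using super[of x] by (simp add: 2 zero_ereal_def[symmetric])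
    qed (use 2 in auto)
  next
    case 3
    show thesis
    proof (rule that[of 0 1])
      show "2 * (x \<bullet> F1 x) + 0 * (norm (G1 x))\<^sup>2 \<le> - \<alpha>1 * (norm x)\<^sup>2" for x
        using lin[of x] by (simp add: 3 zero_ereal_def[symmetric])
      show "2 * (x \<bullet> F x) + 1 * (norm (G x))\<^sup>2 \<le> \<alpha>2 * (norm x)\<^sup>2" for x
        using super[of x] by (simp add: 3(1))
    qed (use 3 in auto)
  qed
qed

text \<open>The bound on \<phi>^pbar gives \<phi>(\<Delta>) \<le> \<Delta>^(-1/4), hence \<Delta> (c
  + \<phi>(\<Delta>))^2 \<le> (c + 1)^2 sqrt \<Delta>, which tends to 0.\<close>

lemma trunc_step_small:
  assumes step: "trunc_step pbar \<mu> \<phi>" and pbar: "pbar > 0" and c: "c \<ge> 0" and \<epsilon>: "\<epsilon> > 0"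
  obtains \<Delta>hat where "\<Delta>hat \<in> {0<..<1}"
    "\<And>\<Delta>. \<Delta> \<in> {0<..<\<Delta>hat} \<Longrightarrow> \<Delta> * (c + \<phi> \<Delta>)\<^sup>2 \<le> \<epsilon>"
proof (rule that)
  \<comment> \<open>The second entry solves (c + 1)^2 sqrt \<Delta> = \<epsilon>; the entry 1/2
    keeps the threshold below 1.\<close>
  let ?\<Delta>hat = "min (1 / 2) ((\<epsilon> / (c + 1)\<^sup>2)\<^sup>2)"
  show "?\<Delta>hat \<in> {0<..<1}" using \<epsilon> c by auto
  fix \<Delta> assume "\<Delta> \<in> {0<..<?\<Delta>hat}"
  then have \<Delta>: "0 < \<Delta>" "\<Delta> \<le> 1" "\<Delta> < (\<epsilon> / (c + 1)\<^sup>2)\<^sup>2" by auto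
  define q where "q = \<Delta> powr (- 1 / 4)"
  have \<phi>: "\<phi> \<Delta> > 0" "\<phi> \<Delta> powr pbar \<le> \<Delta> powr (- pbar / 4)"
    using step \<Delta> by (auto simp: trunc_step_def)
  have q1: "1 \<le> q" using \<Delta> powr_mono'[of "- 1 / 4" 0 \<Delta>] by (simp add: q_def)
  have "\<phi> \<Delta> powr pbar \<le> q powr pbar" using \<phi>(2) by (simp add: q_def powr_powr)
  then have "\<phi> \<Delta> \<le> q"
    using powr_less_mono2[of pbar q "\<phi> \<Delta>"] pbar \<phi>(1) q1 by (meson not_le order_trans zero_le_one)
  moreover have "c \<le> c * q" using c q1 by (simp add: mult_le_cancel_left1)
  ultimately have "c + \<phi> \<Delta> \<le> (c + 1) * q" by (simp add: algebra_simps)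
  then have "\<Delta> * (c + \<phi> \<Delta>)\<^sup>2 \<le> \<Delta> * ((c + 1) * q)\<^sup>2"
    using \<phi> c \<Delta> by (intro mult_left_mono power_mono) auto
  also have "\<dots> = (c + 1)\<^sup>2 * (\<Delta> * q\<^sup>2)" by (simp add: power_mult_distrib)
  also have "\<Delta> * q\<^sup>2 = sqrt \<Delta>"
  proof -
    have "q\<^sup>2 = \<Delta> powr (- 1 / 2)" by (simp add: q_def power2_eq_square powr_add[symmetric])
    then have "\<Delta> * q\<^sup>2 = \<Delta> powr 1 * \<Delta> powr (- 1 / 2)" using \<Delta> by simp
    also have "\<dots> = \<Delta> powr (1 / 2)" by (simp only: powr_add[symmetric]) simp
    finally show ?thesis using \<Delta> by (simp add: powr_half_sqrt)
  qed
  also have "(c + 1)\<^sup>2 * sqrt \<Delta> \<le> (c + 1)\<^sup>2 * (\<epsilon> / (c + 1)\<^sup>2)"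
    using real_sqrt_less_mono[OF \<Delta>(3)] \<epsilon> c by (intro mult_left_mono) auto
  also have "\<dots> = \<epsilon>" using c by simp
  finally show "\<Delta> * (c + \<phi> \<Delta>)\<^sup>2 \<le> \<epsilon>" .
qed

section \<open>Mean square decay of the scheme\<close>


context jump_diffusion_noise
begin

lemma integrable_square_linear_growth:
  fixes X :: "'a \<Rightarrow> real ^ 'd" and q :: "real ^ 'd \<Rightarrow> 'b :: euclidean_space"
  assumes X [measurable]: "X \<in> borel_measurable M" "integrable M (\<lambda>\<omega>. (norm (X \<omega>))\<^sup>2)"
    and q: "q \<in> borel_measurable borel" "\<And>x. norm (q x) \<le> c * norm x"
  shows "integrable M (\<lambda>\<omega>. (norm (q (X \<omega>)))\<^sup>2)"
proof (rule Bochner_Integration.integrable_bound)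
  show "integrable M (\<lambda>\<omega>. c\<^sup>2 * (norm (X \<omega>))\<^sup>2)" using X by simp
  have [measurable]: "(\<lambda>\<omega>. q (X \<omega>)) \<in> borel_measurable M"
    by (rule measurable_compose[OF X(1) q(1)])
  show "(\<lambda>\<omega>. (norm (q (X \<omega>)))\<^sup>2) \<in> borel_measurable M" by measurable
  have "(norm (q x))\<^sup>2 \<le> c\<^sup>2 * (norm x)\<^sup>2" for x
    using power_mono[OF q(2)[of x], of 2] by (simp add: power_mult_distrib)
  then show "AE \<omega> in M. norm ((norm (q (X \<omega>)))\<^sup>2) \<le> norm (c\<^sup>2 * (norm (X \<omega>))\<^sup>2)"
    by simp
qed

text \<open>Adaptedness and square integrability are carried through the induction together with the
  bound, since the moment formula for the next step requires both. The hypothesis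
  \<open>contraction\<close> is the integrand of that formula bounded pointwise.\<close>

lemma one_step_scheme_second_moment:
  fixes X :: "nat \<Rightarrow> 'a \<Rightarrow> real ^ 'd" and f h :: "real ^ 'd \<Rightarrow> real ^ 'd"
    and g :: "real ^ 'd \<Rightarrow> real ^ 'm ^ 'd"
  assumes \<Delta>: "\<Delta> > 0" and \<rho>: "\<rho> \<ge> 0"
    and f: "f \<in> borel_measurable borel" "\<And>x. norm (f x) \<le> c * norm x"
    and g: "g \<in> borel_measurable borel" "\<And>x. norm (g x) \<le> c * norm x"
    and h: "h \<in> borel_measurable borel" "\<And>x. norm (h x) \<le> c * norm x"
    and contraction: "\<And>x. (norm (x + \<Delta> *\<^sub>R f x))\<^sup>2 + \<Delta> * (norm (g x))\<^sup>2
      + (lam * \<Delta> + (lam * \<Delta>)\<^sup>2) * (norm (h x))\<^sup>2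
      + 2 * (lam * \<Delta>) * ((x + \<Delta> *\<^sub>R f x) \<bullet> h x) \<le> \<rho> * (norm x)\<^sup>2"
    and X0: "\<And>\<omega>. X 0 \<omega> = x0"
    and X_Suc: "\<And>k \<omega>. X (Suc k) \<omega> = X k \<omega> + \<Delta> *\<^sub>R f (X k \<omega>)
      + g (X k \<omega>) *v (B (real (Suc k) * \<Delta>) \<omega> - B (real k * \<Delta>) \<omega>)
      + dN (real k * \<Delta>) (real (Suc k) * \<Delta>) \<omega> *\<^sub>R h (X k \<omega>)"
  shows "X k \<in> borel_measurable (\<F> (real k * \<Delta>)) \<and> integrable M (\<lambda>\<omega>. (norm (X k \<omega>))\<^sup>2) \<and>
    expectation (\<lambda>\<omega>. (norm (X k \<omega>))\<^sup>2) \<le> (norm x0)\<^sup>2 * \<rho> ^ k"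
proof (induction k)
  case 0
  then show ?case by (simp add: X0 prob_space)
next
  case (Suc k)
  let ?s = "real k * \<Delta>" and ?t = "real (Suc k) * \<Delta>"
  have st: "0 \<le> ?s" "?s < ?t" "?t - ?s = \<Delta>" using \<Delta> by (auto simp: algebra_simps)
  have X: "X k \<in> borel_measurable (\<F> ?s)" "integrable M (\<lambda>\<omega>. (norm (X k \<omega>))\<^sup>2)"
    and bound: "expectation (\<lambda>\<omega>. (norm (X k \<omega>))\<^sup>2) \<le> (norm x0)\<^sup>2 * \<rho> ^ k"
    using Suc.IH by auto
  have XM: "X k \<in> borel_measurable M" by (rule filtration_measurable[OF st(1) X(1)])
  define a where "a = (\<lambda>x. x + \<Delta> *\<^sub>R f x)"
  have a: "a \<in> borel_measurable borel" "norm (a x) \<le> (1 + \<Delta> * c) * norm x" for x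
  proof -
    show "a \<in> borel_measurable borel" unfolding a_def using f(1) by measurable
    have "norm (a x) \<le> norm x + \<Delta> * norm (f x)"
      using norm_triangle_ineq[of x "\<Delta> *\<^sub>R f x"] \<Delta> by (simp add: a_def)
    also have "\<dots> \<le> norm x + \<Delta> * (c * norm x)" using f(2)[of x] \<Delta> by simp
    finally show "norm (a x) \<le> (1 + \<Delta> * c) * norm x" by (simp add: algebra_simps)
  qed
  note comp = measurable_compose[OF X(1)] and int = integrable_square_linear_growth[OF XM X(2)]
  have X_Suc': "X (Suc k) \<omega> = a (X k \<omega>) + g (X k \<omega>) *v (B ?t \<omega> - B ?s \<omega>) + dN ?s ?t \<omega> *\<^sub>R h (X k \<omega>)" for \<omega>
    by (simp only: X_Suc a_def)
  have meas: "X (Suc k) \<in> borel_measurable (\<F> ?t)"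
  proof -
    note later = filtration_mono[OF st(1) less_imp_le[OF st(2)]]
    have [measurable]: "(\<lambda>\<omega>. a (X k \<omega>)) \<in> borel_measurable (\<F> ?t)"
      "(\<lambda>\<omega>. h (X k \<omega>)) \<in> borel_measurable (\<F> ?t)"
      "(\<lambda>\<omega>. column j (g (X k \<omega>))) \<in> borel_measurable (\<F> ?t)"
      "dN ?s ?t \<in> borel_measurable (\<F> ?t)" "dB ?s ?t j \<in> borel_measurable (\<F> ?t)" for j
      using later[OF comp[OF a(1)]] later[OF comp[OF h(1)]]
        later[OF measurable_compose[OF comp[OF g(1)] borel_measurable_column]]
        dN_adapted[of ?s ?t ?t] dB_adapted[of ?s ?t ?t] st by auto
    \<comment> \<open>Writing the matrix-vector product through columns reduces measurability to
      that of scalar multiples and finite sums.\<close>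
    have "X (Suc k) = (\<lambda>\<omega>. a (X k \<omega>) + (\<Sum>j\<in>UNIV. dB ?s ?t j \<omega> *\<^sub>R column j (g (X k \<omega>)))
        + dN ?s ?t \<omega> *\<^sub>R h (X k \<omega>))"
      by (simp only: fun_eq_iff X_Suc' matrix_vector_mult_columns dB_def) simp
    also have "\<dots> \<in> borel_measurable (\<F> ?t)" by measurable
    finally show ?thesis .
  qed
  have cross: "integrable M (\<lambda>\<omega>. a (X k \<omega>) \<bullet> h (X k \<omega>))"
    by (rule integrable_inner_square_integrable[OF measurable_compose[OF XM a(1)]
        measurable_compose[OF XM h(1)] int[OF a] int[OF h]])
  have step: "has_bochner_integral M (\<lambda>\<omega>. (norm (X (Suc k) \<omega>))\<^sup>2)
      (expectation (\<lambda>\<omega>. (norm (a (X k \<omega>)))\<^sup>2) + \<Delta> * expectation (\<lambda>\<omega>. (norm (g (X k \<omega>)))\<^sup>2)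
       + (lam * \<Delta> + (lam * \<Delta>)\<^sup>2) * expectation (\<lambda>\<omega>. (norm (h (X k \<omega>)))\<^sup>2)
       + 2 * (lam * \<Delta>) * expectation (\<lambda>\<omega>. a (X k \<omega>) \<bullet> h (X k \<omega>)))"
    unfolding X_Suc'
    using increment_second_moment[OF st(1,2) comp[OF a(1)] int[OF a] comp[OF g(1)] int[OF g]
        comp[OF h(1)] int[OF h]] unfolding st(3) .
  have "expectation (\<lambda>\<omega>. (norm (X (Suc k) \<omega>))\<^sup>2) = expectation (\<lambda>\<omega>. (norm (a (X k \<omega>)))\<^sup>2
      + \<Delta> * (norm (g (X k \<omega>)))\<^sup>2 + (lam * \<Delta> + (lam * \<Delta>)\<^sup>2) * (norm (h (X k \<omega>)))\<^sup>2
      + 2 * (lam * \<Delta>) * (a (X k \<omega>) \<bullet> h (X k \<omega>)))"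
    using has_bochner_integral_integral_eq[OF step] int[OF a] int[OF g] int[OF h] cross by simp
  also have "\<dots> \<le> expectation (\<lambda>\<omega>. \<rho> * (norm (X k \<omega>))\<^sup>2)"
    using int[OF a] int[OF g] int[OF h] cross X(2) contraction
    by (intro integral_mono) (auto simp: a_def)
  also have "\<dots> \<le> \<rho> * ((norm x0)\<^sup>2 * \<rho> ^ k)"
    using bound \<rho> by (simp add: mult_left_mono)
  finally have "expectation (\<lambda>\<omega>. (norm (X (Suc k) \<omega>))\<^sup>2) \<le> (norm x0)\<^sup>2 * \<rho> ^ Suc k"
    by (simp add: mult_ac)
  then show ?case using meas step by (auto simp: has_bochner_integral_iff)
qed

end

section \<open>Pointwise contraction and exponential decay\<close>

lemma one_step_contraction:
  fixes x f h :: "'v :: real_inner" and g :: "'w :: real_normed_vector"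
  assumes \<Delta>: "\<Delta> > 0" and lam: "lam > 0" and K1: "K1 \<ge> 0"
    and drift: "2 * (x \<bullet> f) + (norm g)\<^sup>2 \<le> - \<beta> * (norm x)\<^sup>2"
    and f: "norm f \<le> c * norm x" and h: "norm h \<le> K1 * norm x"
    and small: "\<Delta> * (c + lam * K1)\<^sup>2 \<le> \<epsilon>"
  shows "(norm (x + \<Delta> *\<^sub>R f))\<^sup>2 + \<Delta> * (norm g)\<^sup>2 + (lam * \<Delta> + (lam * \<Delta>)\<^sup>2) * (norm h)\<^sup>2
      + 2 * (lam * \<Delta>) * ((x + \<Delta> *\<^sub>R f) \<bullet> h)
    \<le> exp (- (\<beta> - lam * K1 * (2 + K1) - \<epsilon>) * \<Delta>) * (norm x)\<^sup>2" (is "?lhs \<le> _")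
proof -
  \<comment> \<open>All terms of order \<Delta>^2, namely |f|^2, \<lambda>^2 |h|^2 and 2 \<lambda> f
    \<bullet> h, form the single square |f + \<lambda> h|^2; the remaining ones are the drift and
    jump terms of order \<Delta>.\<close>
  have "?lhs = (norm x)\<^sup>2 + \<Delta> * (2 * (x \<bullet> f) + (norm g)\<^sup>2)
      + lam * \<Delta> * ((norm h)\<^sup>2 + 2 * (x \<bullet> h)) + \<Delta> * (\<Delta> * (norm (f + lam *\<^sub>R h))\<^sup>2)"
    unfolding power2_norm_eq_inner
    by (simp add: inner_add_left inner_add_right inner_commute power2_eq_square algebra_simps)
  also have "\<dots> \<le> (norm x)\<^sup>2 + \<Delta> * (- \<beta> * (norm x)\<^sup>2)
      + lam * \<Delta> * (K1 * (2 + K1) * (norm x)\<^sup>2) + \<Delta> * (\<epsilon> * (norm x)\<^sup>2)"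
  proof (intro add_mono mult_left_mono order_refl drift)
    have "(norm h)\<^sup>2 \<le> (K1 * norm x)\<^sup>2" using h by (intro power_mono) auto
    moreover have "x \<bullet> h \<le> norm x * (K1 * norm x)"
      using norm_cauchy_schwarz[of x h] mult_left_mono[OF h norm_ge_zero[of x]] by linarith
    ultimately show "(norm h)\<^sup>2 + 2 * (x \<bullet> h) \<le> K1 * (2 + K1) * (norm x)\<^sup>2"
      by (simp add: power2_eq_square algebra_simps)
    have "norm (f + lam *\<^sub>R h) \<le> norm f + lam * norm h"
      using norm_triangle_ineq[of f "lam *\<^sub>R h"] lam by simp
    also have "\<dots> \<le> (c + lam * K1) * norm x"
      using add_mono[OF f mult_left_mono[OF h less_imp_le[OF lam]]] by (simp add: algebra_simps)
    finally have "(norm (f + lam *\<^sub>R h))\<^sup>2 \<le> ((c + lam * K1) * norm x)\<^sup>2" by (intro power_mono) auto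
    then have "\<Delta> * (norm (f + lam *\<^sub>R h))\<^sup>2 \<le> (\<Delta> * (c + lam * K1)\<^sup>2) * (norm x)\<^sup>2"
      using \<Delta> by (simp add: power_mult_distrib mult_ac)
    also have "\<dots> \<le> \<epsilon> * (norm x)\<^sup>2" using small by (intro mult_right_mono) auto
    finally show "\<Delta> * (norm (f + lam *\<^sub>R h))\<^sup>2 \<le> \<epsilon> * (norm x)\<^sup>2" .
  qed (use \<Delta> lam in auto)
  also have "\<dots> = (1 + (- (\<beta> - lam * K1 * (2 + K1) - \<epsilon>) * \<Delta>)) * (norm x)\<^sup>2"
    by (simp add: algebra_simps)
  also have "\<dots> \<le> exp (- (\<beta> - lam * K1 * (2 + K1) - \<epsilon>) * \<Delta>) * (norm x)\<^sup>2"
    by (intro mult_right_mono exp_ge_add_one_self) auto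
  finally show ?thesis .
qed

text \<open>With the nonnegative integral as expectation, the bound also asserts that the second
  moment is finite.\<close>

theorem theorem4p3:
  fixes M :: "'a measure" and \<F> :: "real \<Rightarrow> 'a measure"
    and B :: "real \<Rightarrow> 'a \<Rightarrow> real ^ 'm" and N :: "real \<Rightarrow> 'a \<Rightarrow> nat"
    and F1 F h :: "real ^ 'd \<Rightarrow> real ^ 'd"
    and G1 G :: "real ^ 'd \<Rightarrow> real ^ 'm ^ 'd"
    and \<mu> \<phi> :: "real \<Rightarrow> real"
    and lam L1 \<gamma> rbar L2 pbar K2 K1 \<alpha>1 \<alpha>2 \<epsilon> :: real
    and \<theta> :: ereal
  assumes "prob_space M" and "complete_measure M" and "usual_conditions M \<F>"
    and "brownian_motion M \<F> B"
    and "lam > 0" and "poisson_process M \<F> lam N"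
    and "L1 > 0" and "\<gamma> \<ge> 0"
    and "\<And>x y. max (max (norm (F1 x - F1 y)) (norm (G1 x - G1 y))) (norm (h x - h y))
                 \<le> L1 * norm (x - y)"
    and "\<And>x y. max (norm (F x - F y)) (norm (G x - G y))
                 \<le> L1 * (1 + npow (norm x) \<gamma> + npow (norm y) \<gamma>) * norm (x - y)"
    and "rbar > 2" and "L2 > 0"
    and "\<And>x y. (x - y) \<bullet> (F x - F y) + (rbar - 1) / 2 * (norm (G x - G y))\<^sup>2
                 \<le> L2 * (norm (x - y))\<^sup>2"
    and "pbar > rbar" and "K2 > 0"
    and "\<And>x. x \<bullet> F x + (pbar - 1) / 2 * (norm (G x))\<^sup>2 \<le> K2 * (1 + (norm x)\<^sup>2)"
    and "F1 0 + F 0 = 0" and "G1 0 + G 0 = 0" and "h 0 = 0"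
    and "K1 > 0"
    and "\<And>x. max (max (norm (F1 x)) (norm (G1 x))) (norm (h x)) \<le> K1 * norm x"
    and "\<alpha>1 > 0" and "\<alpha>2 > 0" and "\<alpha>1 \<ge> \<alpha>2 + lam * K1 * (2 + K1)"
    and "dissipative_split F1 F G1 G \<alpha>1 \<alpha>2 \<theta>"
    and "trunc_growth F G \<mu>" and "trunc_step pbar \<mu> \<phi>"
    and "\<epsilon> \<in> {0<..<\<alpha>1 - \<alpha>2 - lam * K1 * (2 + K1)}"
  shows "\<exists>\<Delta>hat\<in>{0<..<1}. \<forall>\<Delta>\<in>{0<..<\<Delta>hat}. \<forall>x0 :: real ^ 'd. \<forall>k :: nat.
           (\<integral>\<^sup>+ \<omega>. ennreal ((norm (truncated_EM F1 F G1 G h \<mu> \<phi> B N \<Delta> x0 k \<omega>))\<^sup>2) \<partial>M)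
             \<le> ennreal ((norm x0)\<^sup>2 *
                  exp (- (\<alpha>1 - \<alpha>2 - lam * K1 * (2 + K1) - \<epsilon>) * (real k * \<Delta>)))"
proof -
  interpret jump_diffusion_noise M \<F> B N lam
    using assms by (intro jump_diffusion_noise.intro jump_diffusion_noise_axioms.intro)
  \<comment> \<open>Only the sums of the coefficients are assumed to vanish at 0; the linear bound
    gives this for \<open>F1\<close> and \<open>G1\<close>, hence for \<open>F\<close> and
    \<open>G\<close>.\<close>
  have "norm (F1 0) \<le> 0" "norm (G1 0) \<le> 0" using assms(21)[of 0] by auto
  then have F0: "F 0 = 0" and G0: "G 0 = 0" using assms(17,18) by auto
  have lin: "norm (F1 x) \<le> K1 * norm x" "norm (G1 x) \<le> K1 * norm x" "norm (h x) \<le> K1 * norm x" for x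
    using assms(21)[of x] by auto
  \<comment> \<open>Global Lipschitz continuity is weakened to the polynomial form with exponent 0,
    where the bracket equals 3.\<close>
  have Lip: "norm (F1 x - F1 y) \<le> L1 * (1 + npow (norm x) 0 + npow (norm y) 0) * norm (x - y)"
    "norm (G1 x - G1 y) \<le> L1 * (1 + npow (norm x) 0 + npow (norm y) 0) * norm (x - y)"
    "norm (h x - h y) \<le> L1 * (1 + npow (norm x) 0 + npow (norm y) 0) * norm (x - y)" for x y
  proof -
    have "L1 * norm (x - y) \<le> L1 * 3 * norm (x - y)" using assms(7) by (intro mult_right_mono) auto
    then show "norm (F1 x - F1 y) \<le> L1 * (1 + npow (norm x) 0 + npow (norm y) 0) * norm (x - y)"
      "norm (G1 x - G1 y) \<le> L1 * (1 + npow (norm x) 0 + npow (norm y) 0) * norm (x - y)"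
      "norm (h x - h y) \<le> L1 * (1 + npow (norm x) 0 + npow (norm y) 0) * norm (x - y)"
      using assms(9)[of x y] by (auto simp: npow_def)
  qed
  have poly: "norm (F x - F y) \<le> L1 * (1 + npow (norm x) \<gamma> + npow (norm y) \<gamma>) * norm (x - y)"
    "norm (G x - G y) \<le> L1 * (1 + npow (norm x) \<gamma> + npow (norm y) \<gamma>) * norm (x - y)" for x y
    using assms(10)[of x y] by auto
  have cont: "continuous_on UNIV F1" "continuous_on UNIV G1" "continuous_on UNIV h"
    "continuous_on UNIV F" "continuous_on UNIV G"
    using continuous_on_poly_Lipschitz[of L1 0 F1] continuous_on_poly_Lipschitz[of L1 0 G1]
      continuous_on_poly_Lipschitz[of L1 0 h] continuous_on_poly_Lipschitz[of L1 \<gamma> F]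
      continuous_on_poly_Lipschitz[of L1 \<gamma> G] Lip poly assms(7,8) by auto
  note borel = cont[THEN borel_measurable_continuous_onI]
  obtain \<kappa>1 \<kappa>2 where \<kappa>: "\<kappa>1 \<ge> 0" "\<kappa>2 \<ge> 0"
    "\<And>x. 2 * (x \<bullet> F1 x) + \<kappa>1 * (norm (G1 x))\<^sup>2 \<le> - \<alpha>1 * (norm x)\<^sup>2"
    "\<And>x. 2 * (x \<bullet> F x) + \<kappa>2 * (norm (G x))\<^sup>2 \<le> \<alpha>2 * (norm x)\<^sup>2"
    "\<And>x y. (norm (G1 x + G y))\<^sup>2 \<le> \<kappa>1 * (norm (G1 x))\<^sup>2 + \<kappa>2 * (norm (G y))\<^sup>2"
    by (rule dissipative_splitE[OF assms(25)]) (rule that)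
  \<comment> \<open>\<open>c + \<phi> \<Delta>\<close> bounds the growth of f + \<lambda> h:
    \<open>K1\<close> from \<open>F1\<close>, \<open>3 * L1 + \<phi> \<Delta>\<close> from the
    truncated \<open>F\<close>, and \<open>lam * K1\<close> from the jumps. As neither \<Delta> nor
    \<open>x0\<close> enters \<open>c\<close>, the threshold is uniform in the initial
    value.\<close>
  define c where "c = K1 + 3 * L1 + lam * K1"
  have c: "c \<ge> 0" using assms(5,7,20) by (simp add: c_def)
  have "pbar > 0" "\<epsilon> > 0" using assms(11,14,28) by auto
  then obtain \<Delta>hat where \<Delta>hat: "\<Delta>hat \<in> {0<..<1}"
    and small: "\<And>\<Delta>. \<Delta> \<in> {0<..<\<Delta>hat} \<Longrightarrow> \<Delta> * (c + \<phi> \<Delta>)\<^sup>2 \<le> \<epsilon>"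
    using trunc_step_small[OF assms(27) _ c] by blast
  show ?thesis
  proof (rule bexI[OF _ \<Delta>hat], intro ballI allI)
    fix \<Delta> and x0 :: "real ^ 'd" and k :: nat
    assume \<Delta>_in: "\<Delta> \<in> {0<..<\<Delta>hat}"
    then have \<Delta>: "\<Delta> > 0" "\<Delta> \<in> {0<..1}" using \<Delta>hat by auto
    have range: "\<phi> \<Delta> \<in> \<mu> ` {0..}" and \<phi>: "\<phi> \<Delta> \<ge> 0"
      using assms(27) \<Delta>(2) by (auto simp: trunc_step_def intro: less_imp_le)
    have growth: "norm (F x) \<le> \<mu> n" "norm (G x) \<le> \<mu> n" if "n \<ge> 1" "norm x \<le> n" for n x
      using assms(26) that by (auto simp: trunc_growth_def)
    let ?\<pi> = "trunc_proj \<mu> \<phi> \<Delta> :: real ^ 'd \<Rightarrow> real ^ 'd"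
    define f where "f = (\<lambda>x. F1 x + F (?\<pi> x))"
    define g where "g = (\<lambda>x. G1 x + G (?\<pi> x))"
    define C where "C = K1 + 3 * L1 + \<phi> \<Delta>"
    have F_growth: "norm (F (?\<pi> x)) \<le> (3 * L1 + \<phi> \<Delta>) * norm x" for x
      by (rule trunc_linear_growth[where \<phi>=\<phi> and \<Delta>=\<Delta>, OF range \<phi> F0 less_imp_le[OF assms(7)] assms(8) poly(1)])
        (rule growth(1))
    have G_growth: "norm (G (?\<pi> x)) \<le> (3 * L1 + \<phi> \<Delta>) * norm x" for x
      by (rule trunc_linear_growth[where \<phi>=\<phi> and \<Delta>=\<Delta>, OF range \<phi> G0 less_imp_le[OF assms(7)] assms(8) poly(2)])
        (rule growth(2))
    have f: "norm (f x) \<le> C * norm x" and g: "norm (g x) \<le> C * norm x" for x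
      using norm_triangle_ineq[of "F1 x" "F (?\<pi> x)"] norm_triangle_ineq[of "G1 x" "G (?\<pi> x)"]
        lin[of x] F_growth[of x] G_growth[of x] by (auto simp: f_def g_def C_def algebra_simps)
    have h: "norm (h x) \<le> C * norm x" for x
      using lin(3)[of x] mult_right_mono[of K1 C "norm x"] assms(7) \<phi> by (simp add: C_def)
    \<comment> \<open>Young's inequality at the points x and its projection splits |g|^2; the linear
      part is then dissipative at x, and \<open>trunc_dissipative\<close> treats the truncated
      part.\<close>
    have drift: "2 * (x \<bullet> f x) + (norm (g x))\<^sup>2 \<le> - (\<alpha>1 - \<alpha>2) * (norm x)\<^sup>2" for x
      using \<kappa>(3)[of x] \<kappa>(5)[of x "?\<pi> x"] assms(23)
        trunc_dissipative[where \<phi>=\<phi> and \<Delta>=\<Delta>, OF range F0 G0 \<kappa>(2) _ \<kappa>(4), of x]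
      by (simp add: f_def g_def inner_add_right algebra_simps)
    have small': "\<Delta> * (C + lam * K1)\<^sup>2 \<le> \<epsilon>"
      using small[OF \<Delta>_in] by (simp add: C_def c_def add_ac)
    define \<rho> where "\<rho> = exp (- (\<alpha>1 - \<alpha>2 - lam * K1 * (2 + K1) - \<epsilon>) * \<Delta>)"
    define X where "X = truncated_EM F1 F G1 G h \<mu> \<phi> B N \<Delta> x0"
    have "X k \<in> borel_measurable (\<F> (real k * \<Delta>)) \<and> integrable M (\<lambda>\<omega>. (norm (X k \<omega>))\<^sup>2) \<and>
      expectation (\<lambda>\<omega>. (norm (X k \<omega>))\<^sup>2) \<le> (norm x0)\<^sup>2 * \<rho> ^ k"
    proof (rule one_step_scheme_second_moment[OF \<Delta>(1) _ _ f _ g _ h])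
      show "f \<in> borel_measurable borel" "g \<in> borel_measurable borel"
        unfolding f_def g_def using borel measurable_compose[OF borel_measurable_trunc_proj borel(4)]
          measurable_compose[OF borel_measurable_trunc_proj borel(5)]
        by (auto intro!: borel_measurable_add)
      show "(norm (x + \<Delta> *\<^sub>R f x))\<^sup>2 + \<Delta> * (norm (g x))\<^sup>2 + (lam * \<Delta> + (lam * \<Delta>)\<^sup>2) * (norm (h x))\<^sup>2
        + 2 * (lam * \<Delta>) * ((x + \<Delta> *\<^sub>R f x) \<bullet> h x) \<le> \<rho> * (norm x)\<^sup>2" for x
        unfolding \<rho>_def
        by (rule one_step_contraction[OF \<Delta>(1) assms(5) less_imp_le[OF assms(20)] drift f lin(3) small'])
      show "X (Suc k) \<omega> = X k \<omega> + \<Delta> *\<^sub>R f (X k \<omega>)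
        + g (X k \<omega>) *v (B (real (Suc k) * \<Delta>) \<omega> - B (real k * \<Delta>) \<omega>)
        + dN (real k * \<Delta>) (real (Suc k) * \<Delta>) \<omega> *\<^sub>R h (X k \<omega>)" for k \<omega>
        by (simp only: X_def truncated_EM.simps Let_def f_def g_def dN_def)
    qed (auto simp: borel X_def \<rho>_def)
    then have "(\<integral>\<^sup>+ \<omega>. ennreal ((norm (X k \<omega>))\<^sup>2) \<partial>M) \<le> ennreal ((norm x0)\<^sup>2 * \<rho> ^ k)"
      by (subst nn_integral_eq_integral) (auto intro: ennreal_leI)
    also have "\<rho> ^ k = exp (- (\<alpha>1 - \<alpha>2 - lam * K1 * (2 + K1) - \<epsilon>) * (real k * \<Delta>))"
      unfolding \<rho>_def exp_of_nat_mult[symmetric] by (rule arg_cong[of _ _ exp]) (simp only: mult_ac)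
    finally show "(\<integral>\<^sup>+ \<omega>. ennreal ((norm (truncated_EM F1 F G1 G h \<mu> \<phi> B N \<Delta> x0 k \<omega>))\<^sup>2) \<partial>M)
      \<le> ennreal ((norm x0)\<^sup>2 * exp (- (\<alpha>1 - \<alpha>2 - lam * K1 * (2 + K1) - \<epsilon>) * (real k * \<Delta>)))"
      by (simp only: X_def)
  qed
qed

end
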